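(* Let $\{\bar u_b,\bar{\mathbf u}_g\}\in\mathcal B_h$ be any function such that $\bar u_b=Q_b\xi$, $\bar{\mathbf u}_g\cdot\mathbf n=Q_b\nu$ and $\bar{\mathbf u}_g\cdot\boldsymbol\tau=Q_b(\nabla\xi\cdot\boldsymbol\tau)$ on $\partial\Omega$. Define $\bar u_0$ as the solution of the local problems, on each $T\in\mathcal T_h$, $$a_{s,T}(\bar u_h,v)=(f,v_0)_T\qquad\text{for all }v=\{v_0,0,\mathbf 0\}\in\mathcal W_k(T),$$ where $\bar u_h=\{\bar u_0,\bar u_b,\bar{\mathbf u}_g\}$. Then $\bar u_h$ is the solution of the weak Galerkin (WG) scheme if and only if $$S_f(\{\bar u_b,\bar{\mathbf u}_g\})=\{0,\mathbf 0\}.$$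
   Context: **Mesh.** Let $d\in\{2,3\}$ and let $\Omega\subset\mathbb R^d$ be an open bounded domain with Lipschitz boundary. $\mathcal T_h$ is a partition of $\Omega$ into polygons ($d=2$) or polyhedra ($d=3$); $\mathcal E_h$ is the set of all edges/flat faces, and $\mathcal E_h^0=\mathcal E_h\setminus\partial\Omega$ the set of interior ones. $h_T,h_e$ are the diameters of $T\in\mathcal T_h$, $e\in\mathcal E_h$, and $h=\max_T h_T$. $\mathbf n=(n_1,\dots,n_d)$ is the outward unit normal of $T$ on $\partial T$. The partition is shape regular: there are fixed positive constants $\rho_v,\rho_e,\kappa,\sigma_*,\gamma_*$, an angle $\theta_0<\pi/2$ and an integer $N$ such that (1) $\rho_v h_T^d\le|T|$ and $\rho_e h_e^{d-1}\le|e|$; (2) $\kappa h_T\le h_e$ for each edge/face $e$ of $T$; (3) for each $T$ and each edge/face $e$ of $T$ there is a pyramid contained in $T$ with base $e$, apex $A_e\in T$ and height at least $\sigma_*h_T$, such that for every $x\in e$ the angle between $x-A_e$ and the outward normal to $e$ lies in $[0,\theta_0]$; (4) each $T$ has a shape-regular circumscribed simplex $S(T)$ of diameter at most $\gamma_*h_T$, and each $S(T)$ meets at most $N$ of the simplices $S(T')$ of the other elements. **Spaces.** Fix an integer $k\ge2$. $\mathcal W_k(T)=\{\{v_0,v_b,\mathbf v_g\}: v_0\in P_k(T),\ v_b|_e\in P_{k-2}(e),\ \mathbf v_g|_e\in[P_{k-2}(e)]^d,\ e\subset\partial T\}$; $\Lambda_k(\partial T)=\{\{\lambda_b,\boldsymbol\lambda_g\}:\lambda_b|_e\in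 P_{k-2}(e),\ \boldsymbol\lambda_g|_e\in[P_{k-2}(e)]^d,\ e\subset\partial T\}$; $\mathcal W_h=\prod_T\mathcal W_k(T)$, $\Lambda_h=\prod_T\Lambda_k(\partial T)$. Thus boundary components have two independent values on an interior edge/face $e$ shared by $T_1,T_2$, denoted by $L$ (from $T_1$) and $R$ (from $T_2$). $\mathcal V_h$ is the subspace of $v\in\mathcal W_h$ with $\{v_b,\mathbf v_g\}_L=\{v_b,\mathbf v_g\}_R$ on every $e\in\mathcal E_h^0$, and $\mathcal V_h^0=\{v\in\mathcal V_h:v_b=0,\mathbf v_g=\mathbf 0\text{ on }\partial\Omega\}$. $\mathcal B_h=\{\{\mu_b,\boldsymbol\mu_g\}:\mu_b|_e\in P_{k-2}(e),\ \boldsymbol\mu_g|_e\in[P_{k-2}(e)]^d,\ e\in\mathcal E_h\}$ (single-valued on each $e$), and $\mathcal B_h^0$ is its subspace of functions vanishing on $\partial\Omega$. **Forms.** For $v\in\mathcal W_k(T)$ the discrete weak derivative $\partial^2_{ij,w}v\in P_{k-2}(T)$ is defined by $(\partial^2_{ij,w}v,\varphi)_T=(v_0,\partial^2_{ji}\varphi)_T-\langle v_bn_i,\partial_j\varphi\rangle_{\partial T}+\langle v_{gi},\varphi n_j\rangle_{\partial T}$ for all $\varphi\in P_{k-2}(T)$. $Q_b$ is the $L^2$ projection onto $P_{k-2}(e)$ or $[P_{k-2}(e)]^d$ on each $e$. Put $a_T(w,v)=\sum_{i,j=1}^d(\partial^2_{ij,w}w,\partial^2_{ij,w}v)_T$,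 $s_T(w,v)=h_T^{-1}\langle Q_b(\nabla w_0)-\mathbf w_g,Q_b(\nabla v_0)-\mathbf v_g\rangle_{\partial T}+h_T^{-3}\langle Q_bw_0-w_b,Q_bv_0-v_b\rangle_{\partial T}$, $b_T(v,\lambda)=\langle v_b,\lambda_b\rangle_{\partial T}+\langle\mathbf v_g,\boldsymbol\lambda_g\rangle_{\partial T}$, $a_{s,T}=a_T+s_T$, $a_s=\sum_Ta_{s,T}$. **WG scheme.** Given $f\in L^2(\Omega)$ and boundary data $\xi,\nu$, find $\bar u_h=\{\bar u_0,\bar u_b,\bar{\mathbf u}_g\}\in\mathcal V_h$ with $\bar u_b=Q_b\xi$, $\bar{\mathbf u}_g\cdot\mathbf n=Q_b\nu$, $\bar{\mathbf u}_g\cdot\boldsymbol\tau=Q_b(\nabla\xi\cdot\boldsymbol\tau)$ on $\partial\Omega$ (for the tangential direction(s) $\boldsymbol\tau$ to the boundary edges/faces) such that $a_s(\bar u_h,v)=(f,v_0)$ for all $v=\{v_0,v_b,\mathbf v_g\}\in\mathcal V_h^0$. **The operator $S_f:\mathcal B_h\to\mathcal B_h^0$.** Given $\{w_b,\mathbf w_g\}\in\mathcal B_h$: (1) on each $T$ let $w_0=D_f(\{w_b,\mathbf w_g\})\in P_k(T)$ solve $a_{s,T}(w_h,v)=(f,v_0)_T$ for all $v=\{v_0,0,\mathbf 0\}\in\mathcal W_k(T)$, where $w_h=\{w_0,w_b,\mathbf w_g\}$; (2) on each $T$ let $\zeta_{h,T}\in\Lambda_k(\partial T)$ be defined by $b_T(v,\zeta_{h,T})=a_{s,T}(w_h,v)$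 for all $v=\{0,v_b,\mathbf v_g\}\in\mathcal W_k(T)$, giving $\zeta_h=L_f(\{w_b,\mathbf w_g\})\in\Lambda_h$; (3) set $S_f(\{w_b,\mathbf w_g\})=\zeta_{h,L}+\zeta_{h,R}$ on each $e\in\mathcal E_h^0$ and $\{0,\mathbf 0\}$ on each $e\subset\partial\Omega$. *)

theory Defs
  imports "HOL-Analysis.Analysis"
begin

section \<open>Domain and mesh\<close>

text \<open>Near each boundary point, the domain is the epigraph of a Lipschitz function over the
  hyperplane orthogonal to some unit vector \<open>u\<close>.\<close>

definition lipschitz_domain :: "'a::euclidean_space set \<Rightarrow> bool" where
  "lipschitz_domain \<Omega> \<longleftrightarrow>
     open \<Omega> \<and> connected \<Omega> \<and> bounded \<Omega> \<and> \<Omega> \<noteq> {} \<and>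
     (\<forall>x\<in>frontier \<Omega>. \<exists>r>0. \<exists>u L \<gamma>. norm u = 1 \<and> lipschitz_on L UNIV (\<gamma> :: 'a \<Rightarrow> real) \<and>
        \<Omega> \<inter> ball x r = {y \<in> ball x r. y \<bullet> u > \<gamma> (y - (y \<bullet> u) *\<^sub>R u)})"

text \<open>Possibly nonconvex polygons and polyhedra (\<open>m = d\<close>), and flat edges and faces
  (\<open>m = d - 1\<close>): finite unions of convex polytopes spanning one \<open>m\<close>-dimensional affine
  space, with connected relative interior.\<close>

definition polytopal :: "int \<Rightarrow> 'a::euclidean_space set \<Rightarrow> bool" where
  "polytopal m S \<longleftrightarrow>
     aff_dim S = m \<and> connected (rel_interior S) \<and>
     (\<exists>P. finite P \<and> (\<forall>K\<in>P. polytope K \<and> aff_dim K = m) \<and> S = \<Union>P)"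

definition is_unit_normal :: "'a::euclidean_space set \<Rightarrow> 'a \<Rightarrow> bool" where
  "is_unit_normal e n \<longleftrightarrow> norm n = 1 \<and> (\<forall>x\<in>e. \<forall>y\<in>e. (x - y) \<bullet> n = 0)"

definition is_outward_normal :: "'a::euclidean_space set \<Rightarrow> 'a set \<Rightarrow> 'a \<Rightarrow> bool" where
  "is_outward_normal T e n \<longleftrightarrow> is_unit_normal e n \<and>
     (\<forall>x\<in>rel_interior e. \<exists>\<epsilon>>0. \<forall>t. 0 < t \<and> t < \<epsilon> \<longrightarrow>
        x + t *\<^sub>R n \<notin> T \<and> x - t *\<^sub>R n \<in> T)"

definition outward_normal :: "'a::euclidean_space set \<Rightarrow> 'a set \<Rightarrow> 'a" where
  "outward_normal T e = (SOME n. is_outward_normal T e n)"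

text \<open>\<open>F T\<close> is the set of edges/flat faces of the closed element \<open>T\<close>.  It is part of the mesh data
  because a geometric side of \<open>T\<close> is split into several faces when it borders several
  other elements.\<close>

definition all_faces :: "'a set set \<Rightarrow> ('a set \<Rightarrow> 'a set set) \<Rightarrow> 'a set set" where
  "all_faces Th F = (\<Union>T\<in>Th. F T)"

definition interior_faces ::
  "'a::euclidean_space set \<Rightarrow> 'a set set \<Rightarrow> ('a set \<Rightarrow> 'a set set) \<Rightarrow> 'a set set" where
  "interior_faces \<Omega> Th F = {e \<in> all_faces Th F. \<not> e \<subseteq> frontier \<Omega>}"

definition polytopal_element :: "'a::euclidean_space set \<Rightarrow> 'a set set \<Rightarrow> bool" where
  "polytopal_element T FT \<longleftrightarrow>
     polytopal (int DIM('a)) T \<and> finite FT \<and> frontier T = \<Union>FT \<and>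
     (\<forall>e\<in>FT. polytopal (int DIM('a) - 1) e \<and> (\<exists>n. is_outward_normal T e n))"

definition polytopal_mesh ::
  "'a::euclidean_space set \<Rightarrow> 'a set set \<Rightarrow> ('a set \<Rightarrow> 'a set set) \<Rightarrow> bool" where
  "polytopal_mesh \<Omega> Th F \<longleftrightarrow>
     finite Th \<and> \<Union>Th = closure \<Omega> \<and>
     (\<forall>T\<in>Th. polytopal_element T (F T) \<and> interior T \<subseteq> \<Omega>) \<and>
     (\<forall>T\<in>Th. \<forall>T'\<in>Th. T \<noteq> T' \<longrightarrow> interior T \<inter> interior T' = {}) \<and>
     (\<forall>e\<in>all_faces Th F. \<forall>e'\<in>all_faces Th F. e \<noteq> e' \<longrightarrow> rel_interior e \<inter> rel_interior e' = {}) \<and>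
     (\<forall>e\<in>all_faces Th F.
        e \<subseteq> frontier \<Omega> \<and> card {T\<in>Th. e \<in> F T} = 1 \<or>
        rel_interior e \<subseteq> \<Omega> \<and> card {T\<in>Th. e \<in> F T} = 2)"

section \<open>Surface measure\<close>

text \<open>The \<open>(d - 1)\<close>-dimensional Lebesgue measure on a flat face \<open>e\<close> is the image of the
  \<open>d\<close>-dimensional measure on the right prism over \<open>e\<close> of height 1 under the
  orthogonal projection onto the hyperplane of \<open>e\<close> (Fubini).  Either choice of the unit normal
  gives the same measure.\<close>

definition surface :: "'a::euclidean_space set \<Rightarrow> 'a measure" where
  "surface e =
     (let n = (SOME n. is_unit_normal e n); a = (SOME a. a \<in> e) in
      distr (lebesgue_on {x + t *\<^sub>R n | x t. x \<in> e \<and> t \<in> {0..1}}) borel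
        (\<lambda>y. y - ((y - a) \<bullet> n) *\<^sub>R n))"

definition L2 :: "'a::euclidean_space measure \<Rightarrow> ('a \<Rightarrow> real) \<Rightarrow> bool" where
  "L2 M g \<longleftrightarrow> g \<in> borel_measurable M \<and> integrable M (\<lambda>x. (g x)\<^sup>2)"

definition ip :: "'a measure \<Rightarrow> ('a \<Rightarrow> real) \<Rightarrow> ('a \<Rightarrow> real) \<Rightarrow> real" where
  "ip M u v = (LINT x|M. u x * v x)"

definition vip :: "'a measure \<Rightarrow> ('a \<Rightarrow> 'b::euclidean_space) \<Rightarrow> ('a \<Rightarrow> 'b) \<Rightarrow> real" where
  "vip M u v = (LINT x|M. u x \<bullet> v x)"

section \<open>Shape regularity\<close>

definition angle :: "'a::euclidean_space \<Rightarrow> 'a \<Rightarrow> real" where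
  "angle u v = arccos ((u \<bullet> v) / (norm u * norm v))"

text \<open>\<open>S T\<close> is the circumscribed simplex of \<open>T\<close>; its own shape regularity is expressed by a
  ball of radius \<open>\<rho>s * diameter (S T)\<close> contained in it.\<close>

definition shape_regular ::
  "real \<Rightarrow> real \<Rightarrow> real \<Rightarrow> real \<Rightarrow> real \<Rightarrow> real \<Rightarrow> nat \<Rightarrow> real \<Rightarrow>
   'a::euclidean_space set set \<Rightarrow> ('a set \<Rightarrow> 'a set set) \<Rightarrow> bool" where
  "shape_regular \<rho>v \<rho>e \<kappa> \<sigma> \<gamma> \<theta>0 N \<rho>s Th F \<longleftrightarrow>
     \<rho>v > 0 \<and> \<rho>e > 0 \<and> \<kappa> > 0 \<and> \<sigma> > 0 \<and> \<gamma> > 0 \<and> \<theta>0 < pi / 2 \<and> \<rho>s > 0 \<and>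
     (\<forall>T\<in>Th. \<rho>v * diameter T ^ DIM('a) \<le> measure lebesgue T) \<and>
     (\<forall>e\<in>all_faces Th F. \<rho>e * diameter e ^ (DIM('a) - 1) \<le> measure (surface e) e) \<and>
     (\<forall>T\<in>Th. \<forall>e\<in>F T. \<kappa> * diameter T \<le> diameter e) \<and>
     (\<forall>T\<in>Th. \<forall>e\<in>F T. \<exists>A\<in>T.
        (\<Union>x\<in>e. closed_segment A x) \<subseteq> T \<and>
        infdist A (affine hull e) \<ge> \<sigma> * diameter T \<and>
        (\<forall>x\<in>e. angle (x - A) (outward_normal T e) \<in> {0..\<theta>0})) \<and>
     (\<exists>S. \<forall>T\<in>Th. int DIM('a) simplex S T \<and> T \<subseteq> S T \<and>
        diameter (S T) \<le> \<gamma> * diameter T \<and>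
        (\<exists>c. cball c (\<rho>s * diameter (S T)) \<subseteq> S T) \<and>
        card {T'\<in>Th - {T}. S T \<inter> S T' \<noteq> {}} \<le> N)"

section \<open>Polynomial and discrete spaces\<close>

text \<open>\<open>P\<^sub>k\<close>: polynomials of total degree at most \<open>k\<close>.  Elements have nonempty interior, so a
  member of \<open>P\<^sub>k(T)\<close> is identified with the polynomial on the whole space.\<close>

definition Pk :: "nat \<Rightarrow> (real^'n \<Rightarrow> real) set" where
  "Pk k = {p. \<exists>c. p = (\<lambda>x. \<Sum>\<alpha>\<in>{\<alpha>::'n \<Rightarrow> nat. sum \<alpha> UNIV \<le> k}. c \<alpha> * (\<Prod>i\<in>UNIV. (x $ i) ^ \<alpha> i))}"

text \<open>\<open>P\<^sub>k(e)\<close>: restrictions to \<open>e\<close>, extended by zero so that equality of functions is equality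
  on \<open>e\<close>.\<close>

definition Pf :: "nat \<Rightarrow> (real^'n) set \<Rightarrow> (real^'n \<Rightarrow> real) set" where
  "Pf k e = {g. \<exists>p\<in>Pk k. g = (\<lambda>x. if x \<in> e then p x else 0)}"

definition Pfv :: "nat \<Rightarrow> (real^'n) set \<Rightarrow> (real^'n \<Rightarrow> real^'n) set" where
  "Pfv k e = {g. \<forall>i. (\<lambda>x. g x $ i) \<in> Pf k e}"

text \<open>Families of scalar and vector functions indexed by faces; only the values at the faces
  in question (those of \<open>T\<close>, or those of the mesh) matter.  A local WG function is a triple
  \<open>(v0, vb, vg)\<close>, and a WG function assigns one to each element, so its boundary
  components are double-valued on interior faces.\<close>

type_synonym 'n face_fun = "(real^'n) set \<Rightarrow> real^'n \<Rightarrow> real"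
type_synonym 'n face_vfun = "(real^'n) set \<Rightarrow> real^'n \<Rightarrow> real^'n"
type_synonym 'n local_wg = "(real^'n \<Rightarrow> real) \<times> 'n face_fun \<times> 'n face_vfun"
type_synonym 'n wg = "(real^'n) set \<Rightarrow> 'n local_wg"

definition face_space :: "nat \<Rightarrow> (real^'n) set set \<Rightarrow> ('n face_fun \<times> 'n face_vfun) set" where
  "face_space k E = {(b, g). \<forall>e\<in>E. b e \<in> Pf (k - 2) e \<and> g e \<in> Pfv (k - 2) e}"

definition W_local ::
  "((real^'n) set \<Rightarrow> (real^'n) set set) \<Rightarrow> nat \<Rightarrow> (real^'n) set \<Rightarrow> 'n local_wg set" where
  "W_local F k T = {(v0, vb, vg). v0 \<in> Pk k \<and> (vb, vg) \<in> face_space k (F T)}"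

definition Lambda_local ::
  "((real^'n) set \<Rightarrow> (real^'n) set set) \<Rightarrow> nat \<Rightarrow> (real^'n) set \<Rightarrow> ('n face_fun \<times> 'n face_vfun) set"
  where "Lambda_local F k T = face_space k (F T)"

definition Bh ::
  "(real^'n) set set \<Rightarrow> ((real^'n) set \<Rightarrow> (real^'n) set set) \<Rightarrow> nat \<Rightarrow> ('n face_fun \<times> 'n face_vfun) set"
  where "Bh Th F k = face_space k (all_faces Th F)"

definition Wh ::
  "(real^'n) set set \<Rightarrow> ((real^'n) set \<Rightarrow> (real^'n) set set) \<Rightarrow> nat \<Rightarrow> 'n wg set" where
  "Wh Th F k = {v. \<forall>T\<in>Th. v T \<in> W_local F k T}"

definition Vh ::
  "(real^'n) set \<Rightarrow> (real^'n) set set \<Rightarrow> ((real^'n) set \<Rightarrow> (real^'n) set set) \<Rightarrow> nat \<Rightarrow> 'n wg set"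
  where
  "Vh \<Omega> Th F k = {v\<in>Wh Th F k.
     \<forall>e\<in>interior_faces \<Omega> Th F. \<forall>T1\<in>Th. \<forall>T2\<in>Th. e \<in> F T1 \<and> e \<in> F T2 \<longrightarrow>
       fst (snd (v T1)) e = fst (snd (v T2)) e \<and> snd (snd (v T1)) e = snd (snd (v T2)) e}"

definition Vh0 ::
  "(real^'n) set \<Rightarrow> (real^'n) set set \<Rightarrow> ((real^'n) set \<Rightarrow> (real^'n) set set) \<Rightarrow> nat \<Rightarrow> 'n wg set"
  where
  "Vh0 \<Omega> Th F k = {v\<in>Vh \<Omega> Th F k.
     \<forall>T\<in>Th. \<forall>e\<in>F T. e \<subseteq> frontier \<Omega> \<longrightarrow>
       fst (snd (v T)) e = (\<lambda>_. 0) \<and> snd (snd (v T)) e = (\<lambda>_. 0)}"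

section \<open>Weak derivatives, projections and forms\<close>

definition pd :: "'n \<Rightarrow> (real^'n \<Rightarrow> real) \<Rightarrow> real^'n \<Rightarrow> real" where
  "pd i g x = frechet_derivative g (at x) (axis i 1)"

definition grad :: "(real^'n \<Rightarrow> real) \<Rightarrow> real^'n \<Rightarrow> real^'n" where
  "grad g x = (\<chi> i. pd i g x)"

definition weak_d2 ::
  "((real^'n) set \<Rightarrow> (real^'n) set set) \<Rightarrow> nat \<Rightarrow> (real^'n) set \<Rightarrow> 'n \<Rightarrow> 'n \<Rightarrow> 'n local_wg \<Rightarrow>
   real^'n \<Rightarrow> real" where
  "weak_d2 F k T i j = (\<lambda>(v0, vb, vg). SOME \<psi>. \<psi> \<in> Pk (k - 2) \<and>
     (\<forall>\<phi>\<in>Pk (k - 2).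
        ip (lebesgue_on T) \<psi> \<phi> =
          ip (lebesgue_on T) v0 (pd j (pd i \<phi>))
          - (\<Sum>e\<in>F T. ip (surface e) (\<lambda>x. vb e x * outward_normal T e $ i) (pd j \<phi>))
          + (\<Sum>e\<in>F T. ip (surface e) (\<lambda>x. vg e x $ i) (\<lambda>x. \<phi> x * outward_normal T e $ j))))"

definition Qb :: "nat \<Rightarrow> (real^'n) set \<Rightarrow> (real^'n \<Rightarrow> real) \<Rightarrow> real^'n \<Rightarrow> real" where
  "Qb k e g = (SOME q. q \<in> Pf (k - 2) e \<and>
     (\<forall>\<phi>\<in>Pf (k - 2) e. ip (surface e) q \<phi> = ip (surface e) g \<phi>))"

definition Qbv :: "nat \<Rightarrow> (real^'n) set \<Rightarrow> (real^'n \<Rightarrow> real^'n) \<Rightarrow> real^'n \<Rightarrow> real^'n" where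
  "Qbv k e g = (SOME q. q \<in> Pfv (k - 2) e \<and>
     (\<forall>\<phi>\<in>Pfv (k - 2) e. vip (surface e) q \<phi> = vip (surface e) g \<phi>))"

definition a_form ::
  "((real^'n) set \<Rightarrow> (real^'n) set set) \<Rightarrow> nat \<Rightarrow> (real^'n) set \<Rightarrow> 'n local_wg \<Rightarrow> 'n local_wg \<Rightarrow> real"
  where
  "a_form F k T w v =
     (\<Sum>i\<in>UNIV. \<Sum>j\<in>UNIV. ip (lebesgue_on T) (weak_d2 F k T i j w) (weak_d2 F k T i j v))"

definition s_form ::
  "((real^'n) set \<Rightarrow> (real^'n) set set) \<Rightarrow> nat \<Rightarrow> (real^'n) set \<Rightarrow> 'n local_wg \<Rightarrow> 'n local_wg \<Rightarrow> real"
  where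
  "s_form F k T = (\<lambda>(w0, wb, wg) (v0, vb, vg).
     inverse (diameter T) *
       (\<Sum>e\<in>F T. vip (surface e) (\<lambda>x. Qbv k e (grad w0) x - wg e x)
                                 (\<lambda>x. Qbv k e (grad v0) x - vg e x)) +
     inverse (diameter T ^ 3) *
       (\<Sum>e\<in>F T. ip (surface e) (\<lambda>x. Qb k e w0 x - wb e x) (\<lambda>x. Qb k e v0 x - vb e x)))"

definition as_form ::
  "((real^'n) set \<Rightarrow> (real^'n) set set) \<Rightarrow> nat \<Rightarrow> (real^'n) set \<Rightarrow> 'n local_wg \<Rightarrow> 'n local_wg \<Rightarrow> real"
  where "as_form F k T w v = a_form F k T w v + s_form F k T w v"

definition b_form ::
  "((real^'n) set \<Rightarrow> (real^'n) set set) \<Rightarrow> (real^'n) set \<Rightarrow> 'n local_wg \<Rightarrow>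
   'n face_fun \<times> 'n face_vfun \<Rightarrow> real" where
  "b_form F T = (\<lambda>(v0, vb, vg) (lb, lg).
     (\<Sum>e\<in>F T. ip (surface e) (vb e) (lb e)) + (\<Sum>e\<in>F T. vip (surface e) (vg e) (lg e)))"

section \<open>Boundary data and the weak Galerkin scheme\<close>

definition is_tangent :: "'a::euclidean_space set \<Rightarrow> 'a \<Rightarrow> bool" where
  "is_tangent e \<tau> \<longleftrightarrow> norm \<tau> = 1 \<and> (\<forall>n. is_unit_normal e n \<longrightarrow> \<tau> \<bullet> n = 0)"

text \<open>The tangential part of \<open>\<nabla>\<xi>\<close> on a boundary face is understood in the weak
  (\<open>H\<^sup>1(e)\<close>) sense, so that no regularity beyond that needed for \<open>Q\<^sub>b(\<nabla>\<xi> \<cdot> \<tau>)\<close> is imposed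
  on \<open>\<xi>\<close>.  The test functions are \<open>C\<^sup>1\<close> with compact support in the relative interior of \<open>e\<close>.\<close>

definition test_fun :: "'a::euclidean_space set \<Rightarrow> ('a \<Rightarrow> real) \<Rightarrow> bool" where
  "test_fun e \<phi> \<longleftrightarrow> (\<forall>x. \<phi> differentiable at x) \<and>
     (\<forall>v. continuous_on UNIV (\<lambda>x. frechet_derivative \<phi> (at x) v)) \<and>
     (\<exists>K. compact K \<and> K \<subseteq> rel_interior e \<and> (\<forall>x\<in>e - K. \<phi> x = 0))"

definition is_weak_grad :: "(real^'n) set \<Rightarrow> (real^'n \<Rightarrow> real) \<Rightarrow> (real^'n \<Rightarrow> real^'n) \<Rightarrow> bool" where
  "is_weak_grad e \<xi> G \<longleftrightarrow> (\<forall>i. L2 (surface e) (\<lambda>x. G x $ i)) \<and>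
     (\<forall>\<tau> \<phi>. is_tangent e \<tau> \<and> test_fun e \<phi> \<longrightarrow>
        ip (surface e) \<xi> (\<lambda>x. frechet_derivative \<phi> (at x) \<tau>) = - ip (surface e) (\<lambda>x. G x \<bullet> \<tau>) \<phi>)"

definition weak_grad :: "(real^'n) set \<Rightarrow> (real^'n \<Rightarrow> real) \<Rightarrow> real^'n \<Rightarrow> real^'n" where
  "weak_grad e \<xi> = (SOME G. is_weak_grad e \<xi> G)"

definition admissible_data ::
  "(real^'n) set \<Rightarrow> (real^'n) set set \<Rightarrow> ((real^'n) set \<Rightarrow> (real^'n) set set) \<Rightarrow>
   (real^'n \<Rightarrow> real) \<Rightarrow> (real^'n \<Rightarrow> real) \<Rightarrow> bool" where
  "admissible_data \<Omega> Th F \<xi> \<nu> \<longleftrightarrow> (\<forall>e\<in>all_faces Th F. e \<subseteq> frontier \<Omega> \<longrightarrow>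
     L2 (surface e) \<xi> \<and> L2 (surface e) \<nu> \<and> (\<exists>G. is_weak_grad e \<xi> G))"

definition boundary_conditions ::
  "(real^'n) set \<Rightarrow> (real^'n) set set \<Rightarrow> ((real^'n) set \<Rightarrow> (real^'n) set set) \<Rightarrow> nat \<Rightarrow>
   (real^'n \<Rightarrow> real) \<Rightarrow> (real^'n \<Rightarrow> real) \<Rightarrow> 'n wg \<Rightarrow> bool" where
  "boundary_conditions \<Omega> Th F k \<xi> \<nu> u \<longleftrightarrow>
     (\<forall>T\<in>Th. \<forall>e\<in>F T. e \<subseteq> frontier \<Omega> \<longrightarrow>
        (case u T of (u0, ub, ug) \<Rightarrow>
           ub e = Qb k e \<xi> \<and>
           (\<lambda>x. ug e x \<bullet> outward_normal T e) = Qb k e \<nu> \<and>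
           (\<forall>\<tau>. is_tangent e \<tau> \<longrightarrow>
              (\<lambda>x. ug e x \<bullet> \<tau>) = Qb k e (\<lambda>x. weak_grad e \<xi> x \<bullet> \<tau>))))"

text \<open>\<open>(f, v\<^sub>0)\<close> over \<open>\<Omega>\<close>, where \<open>v\<^sub>0\<close> is given elementwise (and so defined up to the skeleton
  of the mesh, a null set).\<close>

definition load ::
  "(real^'n) set \<Rightarrow> (real^'n) set set \<Rightarrow> (real^'n \<Rightarrow> real) \<Rightarrow> 'n wg \<Rightarrow> real" where
  "load \<Omega> Th f v =
     ip (lebesgue_on \<Omega>) f (\<lambda>x. \<Sum>T\<in>Th. indicator (interior T) x * fst (v T) x)"

definition wg_solution ::
  "(real^'n) set \<Rightarrow> (real^'n) set set \<Rightarrow> ((real^'n) set \<Rightarrow> (real^'n) set set) \<Rightarrow> nat \<Rightarrow>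
   (real^'n \<Rightarrow> real) \<Rightarrow> (real^'n \<Rightarrow> real) \<Rightarrow> (real^'n \<Rightarrow> real) \<Rightarrow> 'n wg \<Rightarrow> bool" where
  "wg_solution \<Omega> Th F k f \<xi> \<nu> u \<longleftrightarrow>
     u \<in> Vh \<Omega> Th F k \<and> boundary_conditions \<Omega> Th F k \<xi> \<nu> u \<and>
     (\<forall>v\<in>Vh0 \<Omega> Th F k. (\<Sum>T\<in>Th. as_form F k T (u T) (v T)) = load \<Omega> Th f v)"

section \<open>The interface operator\<close>

text \<open>As with \<open>weak_d2\<close> and \<open>Qb\<close>, \<open>SOME\<close> selects the solution of a linear problem that is
  uniquely solvable (for \<open>Lf\<close>: unique on the faces of \<open>T\<close>, the only values used).\<close>

definition local_solution ::
  "((real^'n) set \<Rightarrow> (real^'n) set set) \<Rightarrow> nat \<Rightarrow> (real^'n \<Rightarrow> real) \<Rightarrow> (real^'n) set \<Rightarrow>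
   'n local_wg \<Rightarrow> bool" where
  "local_solution F k f T = (\<lambda>(w0, wb, wg). w0 \<in> Pk k \<and>
     (\<forall>v0\<in>Pk k. as_form F k T (w0, wb, wg) (v0, \<lambda>_ _. 0, \<lambda>_ _. 0) = ip (lebesgue_on T) f v0))"

definition Df ::
  "((real^'n) set \<Rightarrow> (real^'n) set set) \<Rightarrow> nat \<Rightarrow> (real^'n \<Rightarrow> real) \<Rightarrow> (real^'n) set \<Rightarrow>
   'n face_fun \<times> 'n face_vfun \<Rightarrow> real^'n \<Rightarrow> real" where
  "Df F k f T = (\<lambda>(wb, wg). SOME w0. local_solution F k f T (w0, wb, wg))"

definition Lf ::
  "((real^'n) set \<Rightarrow> (real^'n) set set) \<Rightarrow> nat \<Rightarrow> (real^'n \<Rightarrow> real) \<Rightarrow> (real^'n) set \<Rightarrow>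
   'n face_fun \<times> 'n face_vfun \<Rightarrow> 'n face_fun \<times> 'n face_vfun" where
  "Lf F k f T w = (SOME \<zeta>. \<zeta> \<in> Lambda_local F k T \<and>
     (\<forall>(vb, vg)\<in>face_space k (F T).
        b_form F T (\<lambda>_. 0, vb, vg) \<zeta> = as_form F k T (Df F k f T w, fst w, snd w) (\<lambda>_. 0, vb, vg)))"

text \<open>An interior face belongs to exactly two elements, so the sums below are
  \<open>\<zeta>\<^sub>L + \<zeta>\<^sub>R\<close>.\<close>

definition Sf ::
  "(real^'n) set \<Rightarrow> (real^'n) set set \<Rightarrow> ((real^'n) set \<Rightarrow> (real^'n) set set) \<Rightarrow> nat \<Rightarrow>
   (real^'n \<Rightarrow> real) \<Rightarrow> 'n face_fun \<times> 'n face_vfun \<Rightarrow> 'n face_fun \<times> 'n face_vfun" where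
  "Sf \<Omega> Th F k f w =
     (\<lambda>e x. if e \<in> interior_faces \<Omega> Th F then \<Sum>T\<in>{T\<in>Th. e \<in> F T}. fst (Lf F k f T w) e x else 0,
      \<lambda>e x. if e \<in> interior_faces \<Omega> Th F then \<Sum>T\<in>{T\<in>Th. e \<in> F T}. snd (Lf F k f T w) e x else 0)"

end

theory Submission
  imports Defs
begin

text \<open>The functional \<open>v \<mapsto> a\<^sub>s\<^sub>,\<^sub>T(u\<^sub>h, v)\<close> splits into its values on \<open>{v\<^sub>0, 0, 0}\<close>, which are \<open>(f, v\<^sub>0)\<^sub>T\<close>
  by the local problem, and on \<open>{0, v\<^sub>b, v\<^sub>g}\<close>, which are \<open>b\<^sub>T(v, \<zeta>)\<close> by the definition of \<open>\<zeta>\<close>.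
  Summing over the elements and reordering by faces, the scheme says that \<open>\<zeta>\<^sub>L + \<zeta>\<^sub>R\<close> is
  orthogonal to every single-valued function vanishing on the boundary; it is itself such a
  function, so this means \<open>\<zeta>\<^sub>L + \<zeta>\<^sub>R = 0\<close>.  All operators given by \<open>SOME\<close> are Riesz representatives
  in finite-dimensional spaces of polynomials, on which the \<open>L\<^sup>2\<close> product is definite.\<close>

section \<open>Finite-dimensional function spaces with an \<open>L\<^sup>2\<close> inner product\<close>

text \<open>A value of \<open>SOME\<close> has no algebra of its own. It becomes linear in its data
  only once it is known to be the unique Riesz representative of a functional, so everything hangs
  on definiteness of the pairing on each polynomial space. Definiteness has two sources. On an
  element, a polynomial with vanishing square integral vanishes on a ball and hence everywhere. On a
  face, the measure is an image of Lebesgue measure on a prism, so the integral is pulled back to a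
  solid and continuity carries the zeros to the base; members of \<open>Pf\<close> are zero off the
  face, so vanishing on it makes them zero as functions. The local form is treated as semidefinite
  only. Its null vectors pair to zero with every test function, so the solution picked by
  \<open>Df\<close> and the given \<open>u0\<close> define the same functional; existence of a
  solution for \<open>Df\<close> to pick comes from the hypothesis on \<open>u0\<close>.\<close>

definition lincomb_closed :: "('a \<Rightarrow> 'b::real_vector) set \<Rightarrow> bool" where
  "lincomb_closed V \<longleftrightarrow> (\<lambda>_. 0) \<in> V \<and> (\<forall>u\<in>V. \<forall>v\<in>V. \<forall>c. (\<lambda>x. c *\<^sub>R u x + v x) \<in> V)"

definition linear_form :: "('a \<Rightarrow> 'b::real_vector) set \<Rightarrow> (('a \<Rightarrow> 'b) \<Rightarrow> real) \<Rightarrow> bool" where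
  "linear_form V l \<longleftrightarrow> (\<forall>u\<in>V. \<forall>v\<in>V. \<forall>c. l (\<lambda>x. c *\<^sub>R u x + v x) = c * l u + l v)"

definition lin_span :: "('i \<Rightarrow> 'a \<Rightarrow> 'b::real_vector) \<Rightarrow> 'i set \<Rightarrow> ('a \<Rightarrow> 'b) set" where
  "lin_span m I = {u. \<exists>c. u = (\<lambda>x. \<Sum>i\<in>I. c i *\<^sub>R m i x)}"

lemma lincomb_closedD:
  assumes "lincomb_closed V"
  shows lincomb_closed_zero: "(\<lambda>_. 0) \<in> V"
    and lincomb_closed_lincomb: "u \<in> V \<Longrightarrow> v \<in> V \<Longrightarrow> (\<lambda>x. c *\<^sub>R u x + v x) \<in> V"
  using assms unfolding lincomb_closed_def by blast+

lemma lincomb_closed_diff: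
  assumes "lincomb_closed V" "u \<in> V" "v \<in> V"
  shows "(\<lambda>x. u x - v x) \<in> V"
  using lincomb_closed_lincomb[OF assms(1,3,2), of "-1"] by simp

lemma lincomb_closed_sum:
  assumes "lincomb_closed V" "\<And>i. i \<in> I \<Longrightarrow> u i \<in> V"
  shows "(\<lambda>x. \<Sum>i\<in>I. u i x) \<in> V"
  using assms(2)
proof (induction I rule: infinite_finite_induct)
  case (insert i I)
  then show ?case
    using lincomb_closed_lincomb[OF assms(1), of "u i" "\<lambda>x. \<Sum>i\<in>I. u i x" 1] by simp
qed (auto intro: lincomb_closed_zero[OF assms(1)])

lemma linear_formD:
  "linear_form V l \<Longrightarrow> u \<in> V \<Longrightarrow> v \<in> V \<Longrightarrow> l (\<lambda>x. c *\<^sub>R u x + v x) = c * l u + l v"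
  unfolding linear_form_def by blast

lemma linear_form_zero:
  assumes "linear_form V l" "lincomb_closed V"
  shows "l (\<lambda>_. 0) = 0"
  using linear_formD[OF assms(1) lincomb_closed_zero[OF assms(2)] lincomb_closed_zero[OF assms(2)], of 1]
  by simp

lemma lincomb_closed_lin_span: "lincomb_closed (lin_span m I)"
proof -
  have "(\<lambda>_. 0) \<in> lin_span m I"
    by (auto simp: lin_span_def intro!: exI[of _ "\<lambda>_. 0"])
  moreover have "(\<lambda>x. c *\<^sub>R u x + v x) \<in> lin_span m I"
    if "u \<in> lin_span m I" "v \<in> lin_span m I" for c u v
  proof -
    obtain a b where "u = (\<lambda>x. \<Sum>i\<in>I. a i *\<^sub>R m i x)" "v = (\<lambda>x. \<Sum>i\<in>I. b i *\<^sub>R m i x)"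
      using \<open>u \<in> _\<close> \<open>v \<in> _\<close> unfolding lin_span_def by blast
    then have "(\<lambda>x. c *\<^sub>R u x + v x) = (\<lambda>x. \<Sum>i\<in>I. (c * a i + b i) *\<^sub>R m i x)"
      by (simp add: scaleR_sum_right scaleR_add_left sum.distrib)
    then show ?thesis
      unfolding lin_span_def by (intro CollectI exI)
  qed
  ultimately show ?thesis
    unfolding lincomb_closed_def by blast
qed

text \<open>An enumeration of the index set turns the span into one over an initial segment of the
  naturals, the form on which Gram--Schmidt can induct.\<close>

lemma lin_span_reindex_nat:
  assumes "finite I"
  shows "\<exists>m' (n::nat). lin_span m I = lin_span m' {..<n}"
proof -
  obtain h where h: "bij_betw h {..<card I} I"
    using ex_bij_betw_nat_finite[OF assms] by (auto simp: atLeast0LessThan)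
  have "lin_span m I = lin_span (m \<circ> h) {..<card I}"
  proof (intro set_eqI iffI)
    fix u assume "u \<in> lin_span m I"
    then obtain c where "u = (\<lambda>x. \<Sum>i\<in>I. c i *\<^sub>R m i x)" unfolding lin_span_def by blast
    then have "u = (\<lambda>x. \<Sum>i<card I. (c \<circ> h) i *\<^sub>R (m \<circ> h) i x)"
      by (simp add: sum.reindex_bij_betw[OF h, symmetric])
    then show "u \<in> lin_span (m \<circ> h) {..<card I}" unfolding lin_span_def by (intro CollectI exI)
  next
    fix u assume "u \<in> lin_span (m \<circ> h) {..<card I}"
    then obtain c where "u = (\<lambda>x. \<Sum>i<card I. c i *\<^sub>R (m \<circ> h) i x)" unfolding lin_span_def by blast
    also have "\<dots> = (\<lambda>x. \<Sum>i<card I. (c \<circ> the_inv_into {..<card I} h) (h i) *\<^sub>R m (h i) x)"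
      using h by (auto intro!: sum.cong simp: the_inv_into_f_f bij_betw_def)
    also have "\<dots> = (\<lambda>x. \<Sum>i\<in>I. (c \<circ> the_inv_into {..<card I} h) i *\<^sub>R m i x)"
      by (subst sum.reindex_bij_betw[OF h, where g = "\<lambda>i. (c \<circ> the_inv_into {..<card I} h) i *\<^sub>R m i _"]) simp
    finally show "u \<in> lin_span m I" unfolding lin_span_def by (intro CollectI exI)
  qed
  then show ?thesis by blast
qed

lemma lin_span_Suc:
  assumes "u \<in> lin_span m {..<Suc n}"
  obtains c w where "w \<in> lin_span m {..<n}" "u = (\<lambda>x. c *\<^sub>R m n x + w x)"
proof -
  obtain c where "u = (\<lambda>x. \<Sum>i<Suc n. c i *\<^sub>R m i x)"
    using assms unfolding lin_span_def by blast
  then show ?thesis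
    by (intro that[of "\<lambda>x. \<Sum>i<n. c i *\<^sub>R m i x" "c n"]) (auto simp: lin_span_def add.commute)
qed

lemma lin_span_Suc_mono: "lin_span m {..<n} \<subseteq> lin_span m {..<Suc n}"
proof
  fix u assume "u \<in> lin_span m {..<n}"
  then obtain c where "u = (\<lambda>x. \<Sum>i<n. c i *\<^sub>R m i x)" unfolding lin_span_def by blast
  then show "u \<in> lin_span m {..<Suc n}"
    by (auto simp: lin_span_def intro!: exI[of _ "c(n := 0)"] sum.cong)
qed

lemma generator_in_lin_span:
  assumes "finite I" "i \<in> I"
  shows "m i \<in> lin_span m I"
  using assms unfolding lin_span_def
  by (auto intro!: exI[of _ "\<lambda>j. of_bool (j = i)"] simp: of_bool_def if_distrib[where f = "\<lambda>t. t *\<^sub>R _"]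
      sum.delta cong: if_cong)

section \<open>The \<open>L2\<close> pairing and Riesz representation\<close>

lemma ip_eq_vip: "ip M u v = vip M u v"
  unfolding ip_def vip_def by simp

lemma vip_commute: "vip M u v = vip M v u"
  unfolding vip_def by (simp add: inner_commute)

lemma vip_nonneg: "vip M u u \<ge> 0"
  unfolding vip_def by simp

text \<open>Linearity of the Bochner integral is available for integrable functions; this is the
  source of the integrability obligations in the rest of the development.\<close>

lemma vip_lincomb_left:
  assumes "integrable M (\<lambda>x. u x \<bullet> w x)" "integrable M (\<lambda>x. v x \<bullet> w x)"
  shows "vip M (\<lambda>x. c *\<^sub>R u x + v x) w = c * vip M u w + vip M v w"
  using assms unfolding vip_def by (simp add: inner_add_left)

lemma vip_lincomb_right:
  assumes "integrable M (\<lambda>x. w x \<bullet> u x)" "integrable M (\<lambda>x. w x \<bullet> v x)"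
  shows "vip M w (\<lambda>x. c *\<^sub>R u x + v x) = c * vip M w u + vip M w v"
  using assms unfolding vip_def by (simp add: inner_add_right)

text \<open>The space \<open>V\<close> consists of functions, not of classes modulo null sets; \<open>definite\<close> is what
  makes the identification of almost everywhere equal members unnecessary.\<close>

locale l2_space =
  fixes M :: "'a measure" and V :: "('a \<Rightarrow> 'b::euclidean_space) set"
  assumes finitely_spanned: "\<exists>m (n::nat). V = lin_span m {..<n}"
    and integrable_inner: "u \<in> V \<Longrightarrow> v \<in> V \<Longrightarrow> integrable M (\<lambda>x. u x \<bullet> v x)"
    and definite: "u \<in> V \<Longrightarrow> vip M u u = 0 \<Longrightarrow> u = (\<lambda>_. 0)"
begin

lemma closed: "lincomb_closed V"
  using finitely_spanned lincomb_closed_lin_span by metis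

lemma vip_lincomb_left_V:
  "u \<in> V \<Longrightarrow> v \<in> V \<Longrightarrow> w \<in> V \<Longrightarrow> vip M (\<lambda>x. c *\<^sub>R u x + v x) w = c * vip M u w + vip M v w"
  by (intro vip_lincomb_left integrable_inner)

lemma vip_lincomb_right_V:
  "u \<in> V \<Longrightarrow> v \<in> V \<Longrightarrow> w \<in> V \<Longrightarrow> vip M w (\<lambda>x. c *\<^sub>R u x + v x) = c * vip M w u + vip M w v"
  by (intro vip_lincomb_right integrable_inner)

text \<open>Gram--Schmidt: \<open>r\<close> is the part of the new generator orthogonal to the previous ones.\<close>

lemma riesz_lin_span:
  fixes n :: nat
  assumes "lin_span m {..<n} \<subseteq> V" "linear_form V l"
  shows "\<exists>q\<in>lin_span m {..<n}. \<forall>\<phi>\<in>lin_span m {..<n}. vip M q \<phi> = l \<phi>"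
  using assms
proof (induction n arbitrary: l)
  case 0
  then show ?case
    using linear_form_zero[OF 0(2) closed] by (auto simp: lin_span_def vip_def)
next
  case (Suc n)
  let ?U = "lin_span m {..<n}" and ?U' = "lin_span m {..<Suc n}"
  have UU': "?U \<subseteq> ?U'" by (rule lin_span_Suc_mono)
  have U: "?U \<subseteq> V" using UU' Suc.prems by blast
  have clU: "lincomb_closed ?U" and clU': "lincomb_closed ?U'" by (rule lincomb_closed_lin_span)+
  have mnU': "m n \<in> ?U'" by (rule generator_in_lin_span) auto
  then have mn: "m n \<in> V" using Suc.prems by blast
  \<comment> \<open>The induction hypothesis serves two functionals: pairing with the new generator,
    which gives its projection \<open>p\<close> onto the earlier span, and \<open>l\<close> itself,
    which gives \<open>q0\<close>.\<close>
  have "linear_form V (vip M (m n))"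
    unfolding linear_form_def using mn vip_lincomb_right_V by blast
  then obtain p where p: "p \<in> ?U" "\<And>\<phi>. \<phi> \<in> ?U \<Longrightarrow> vip M p \<phi> = vip M (m n) \<phi>"
    using Suc.IH[OF U] by blast
  obtain q0 where q0: "q0 \<in> ?U" "\<And>\<phi>. \<phi> \<in> ?U \<Longrightarrow> vip M q0 \<phi> = l \<phi>"
    using Suc.IH[OF U Suc.prems(2)] by blast
  define r where "r = (\<lambda>x. (-1) *\<^sub>R p x + m n x)"
  have rU': "r \<in> ?U'" unfolding r_def
    using lincomb_closed_lincomb[OF clU'] p(1) mnU' UU' by blast
  then have r: "r \<in> V" using Suc.prems by blast
  have pV: "p \<in> V" and q0V: "q0 \<in> V" using p q0 U by auto
  have orth: "vip M r \<phi> = 0" if "\<phi> \<in> ?U" for \<phi>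
    unfolding r_def using vip_lincomb_left_V[OF pV mn, of \<phi> "-1"] p(2)[OF that] that U by auto
  have decomp: "\<exists>c w. w \<in> ?U \<and> \<phi> = (\<lambda>x. c *\<^sub>R r x + w x)" if "\<phi> \<in> ?U'" for \<phi>
  proof -
    obtain c w where cw: "w \<in> ?U" "\<phi> = (\<lambda>x. c *\<^sub>R m n x + w x)"
      using \<open>\<phi> \<in> ?U'\<close> by (rule lin_span_Suc)
    have "(\<lambda>x. c *\<^sub>R p x + w x) \<in> ?U" by (rule lincomb_closed_lincomb[OF clU p(1) cw(1)])
    moreover have "\<phi> = (\<lambda>x. c *\<^sub>R r x + (c *\<^sub>R p x + w x))"
      unfolding cw(2) r_def by (simp add: algebra_simps)
    ultimately show ?thesis by (intro exI conjI)
  qed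
  \<comment> \<open>The coefficient along \<open>r\<close> is forced by testing with
    \<open>r\<close>. If the new generator depends on the earlier ones, then \<open>r\<close> is
    zero, division by zero yields \<open>t = 0\<close>, and \<open>l r = 0\<close> keeps the
    equation true.\<close>
  define t where "t = l r / vip M r r"
  define q where "q = (\<lambda>x. t *\<^sub>R r x + q0 x)"
  have qU': "q \<in> ?U'" unfolding q_def
    using lincomb_closed_lincomb[OF clU' rU', of q0 t] q0(1) UU' by blast
  have rr: "t * vip M r r = l r"
  proof (cases "vip M r r = 0")
    case True
    then have "r = (\<lambda>_. 0)" using definite[OF r] by simp
    then show ?thesis using True linear_form_zero[OF Suc.prems(2) closed] by simp
  next
    case False
    then show ?thesis unfolding t_def by simp
  qed
  have "vip M q \<phi> = l \<phi>" if \<phi>: "\<phi> \<in> ?U'" for \<phi>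
  proof -
    obtain c w where cw: "w \<in> ?U" "\<phi> = (\<lambda>x. c *\<^sub>R r x + w x)" using decomp[OF \<phi>] by blast
    have w: "w \<in> V" using cw U by blast
    have q: "q \<in> V" using qU' Suc.prems by blast
    have "vip M q r = l r"
      unfolding q_def using vip_lincomb_left_V[OF r q0V r, of t] orth[OF q0(1)] rr
      by (simp add: vip_commute)
    moreover have "vip M q w = l w"
      unfolding q_def using vip_lincomb_left_V[OF r q0V w, of t] orth[OF cw(1)] q0(2)[OF cw(1)]
      by simp
    ultimately show ?thesis
      unfolding cw(2) vip_lincomb_right_V[OF r w q] linear_formD[OF Suc.prems(2) r w] by simp
  qed
  then show ?case using qU' by blast
qed

text \<open>The shape of the choice is that of \<open>weak_d2\<close>, \<open>Qb\<close> and
  \<open>Qbv\<close>, so that each of them unfolds to an instance.\<close>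

definition riesz :: "(('a \<Rightarrow> 'b) \<Rightarrow> real) \<Rightarrow> 'a \<Rightarrow> 'b" where
  "riesz l = (SOME q. q \<in> V \<and> (\<forall>\<phi>\<in>V. vip M q \<phi> = l \<phi>))"

lemma riesz:
  assumes "linear_form V l"
  shows riesz_in: "riesz l \<in> V" and vip_riesz: "\<phi> \<in> V \<Longrightarrow> vip M (riesz l) \<phi> = l \<phi>"
proof -
  have "\<exists>q\<in>V. \<forall>\<phi>\<in>V. vip M q \<phi> = l \<phi>"
    using finitely_spanned riesz_lin_span[OF _ assms] by auto
  then have "\<exists>q. q \<in> V \<and> (\<forall>\<phi>\<in>V. vip M q \<phi> = l \<phi>)" by blast
  from someI_ex[OF this]
  show "riesz l \<in> V" "\<phi> \<in> V \<Longrightarrow> vip M (riesz l) \<phi> = l \<phi>"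
    unfolding riesz_def by blast+
qed

lemma eq_if_vip_eq:
  assumes "q \<in> V" "q' \<in> V" "\<And>\<phi>. \<phi> \<in> V \<Longrightarrow> vip M q \<phi> = vip M q' \<phi>"
  shows "q = q'"
proof -
  let ?d = "\<lambda>x. (-1) *\<^sub>R q' x + q x"
  have d: "?d \<in> V" by (rule lincomb_closed_lincomb[OF closed assms(2,1)])
  have "vip M ?d ?d = 0"
    using vip_lincomb_left_V[OF assms(2,1) d, of "-1"] assms(3)[OF d] by simp
  then have "?d = (\<lambda>_. 0)" by (rule definite[OF d])
  then show ?thesis by (auto simp: fun_eq_iff)
qed

text \<open>The combination of the representatives represents the combined functional, and
  representatives are unique. Linearity of the projections and of the weak derivatives is derived
  from this.\<close>

lemma riesz_lincomb:
  assumes "linear_form V l1" "linear_form V l2" "linear_form V l"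
    and "\<And>\<phi>. \<phi> \<in> V \<Longrightarrow> l \<phi> = c * l1 \<phi> + l2 \<phi>"
  shows "riesz l = (\<lambda>x. c *\<^sub>R riesz l1 x + riesz l2 x)"
proof (rule eq_if_vip_eq)
  show "riesz l \<in> V" by (rule riesz_in[OF assms(3)])
  show "(\<lambda>x. c *\<^sub>R riesz l1 x + riesz l2 x) \<in> V"
    by (rule lincomb_closed_lincomb[OF closed riesz_in[OF assms(1)] riesz_in[OF assms(2)]])
  fix \<phi> assume "\<phi> \<in> V"
  then show "vip M (riesz l) \<phi> = vip M (\<lambda>x. c *\<^sub>R riesz l1 x + riesz l2 x) \<phi>"
    using vip_lincomb_left_V[OF riesz_in[OF assms(1)] riesz_in[OF assms(2)], of \<phi> c]
    by (simp add: vip_riesz assms)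
qed

end

section \<open>Polynomials\<close>

lemma continuous_on_real_polynomial_function:
  "real_polynomial_function p \<Longrightarrow> continuous_on S p"
  by (simp add: differentiable_imp_continuous_on differentiable_on_real_polynomial_function)

section \<open>Derivatives and zeros of polynomials\<close>

lemma pd_lincomb:
  assumes "p differentiable at x" "q differentiable at x"
  shows "pd i (\<lambda>x. c * p x + q x) x = c * pd i p x + pd i q x"
proof -
  have "((\<lambda>x. c * p x + q x) has_derivative
      (\<lambda>h. c * frechet_derivative p (at x) h + frechet_derivative q (at x) h)) (at x)"
    using assms by (intro derivative_intros) (auto simp: frechet_derivative_works)
  then show ?thesis
    unfolding pd_def by (simp add: frechet_derivative_at[symmetric])
qed

text \<open>Keeps iterated derivatives of test functions within the polynomials, hence continuous
  and integrable on compact elements.\<close>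

lemma real_polynomial_function_pd:
  assumes "real_polynomial_function p"
  shows "real_polynomial_function (pd i p)"
  using assms
proof induction
  case (linear f)
  then have "frechet_derivative f (at x) = f" for x
    using frechet_derivative_at[of f f x] bounded_linear_imp_has_derivative by metis
  then have "pd i f = (\<lambda>_. f (axis i 1))"
    unfolding pd_def by auto
  then show ?case by (simp add: real_polynomial_function.intros(2))
next
  case (const c)
  then show ?case unfolding pd_def by (simp add: real_polynomial_function.intros(2))
next
  case (add f g)
  have "pd i (\<lambda>x. f x + g x) = (\<lambda>x. pd i f x + pd i g x)"
    using pd_lincomb[of f _ g i 1] add.hyps differentiable_at_real_polynomial_function by fastforce
  then show ?case using add.IH by (simp add: real_polynomial_function.intros(3))
next
  case (mult f g)
  have "pd i (\<lambda>x. f x * g x) x = f x * pd i g x + pd i f x * g x" for x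
  proof -
    have "((\<lambda>x. f x * g x) has_derivative
      (\<lambda>h. f x * frechet_derivative g (at x) h + frechet_derivative f (at x) h * g x)) (at x)"
      using mult.hyps differentiable_at_real_polynomial_function
      by (intro derivative_intros) (auto simp: frechet_derivative_works)
    then show ?thesis
      unfolding pd_def by (simp add: frechet_derivative_at[symmetric])
  qed
  then have "pd i (\<lambda>x. f x * g x) = (\<lambda>x. f x * pd i g x + pd i f x * g x)"
    by auto
  then show ?case using mult by (simp add: real_polynomial_function.intros(3) real_polynomial_function.intros(4))
qed

text \<open>Restrict to the line through \<open>a\<close> and \<open>x\<close>: a polynomial in one
  variable with infinitely many roots has zero coefficients.\<close>

lemma real_polynomial_function_eq_0_if_eq_0_on_ball:
  fixes p :: "'a::euclidean_space \<Rightarrow> real"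
  assumes p: "real_polynomial_function p" and "r > 0" and zero: "\<And>x. x \<in> ball a r \<Longrightarrow> p x = 0"
  shows "p x = 0"
proof (cases "x = a")
  case True
  then show ?thesis using zero[of a] \<open>r > 0\<close> by simp
next
  case False
  define g where "g = (\<lambda>t::real. a + t *\<^sub>R (x - a))"
  have "polynomial_function g"
    unfolding g_def
    by (intro polynomial_function_add polynomial_function_const polynomial_function_bounded_linear
        bounded_linear_scaleR_left)
  then have "real_polynomial_function (p \<circ> g)"
    using p by (rule real_polynomial_function_compose)
  then obtain c n where c: "p \<circ> g = (\<lambda>t. \<Sum>i\<le>n. c i * t ^ i)"
    using real_polynomial_function_imp_sum by blast
  \<comment> \<open>For parameters between 0 and \<delta> the point \<open>g t\<close> stays in the
    ball; \<open>x\<close> itself is \<open>g 1\<close>.\<close>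
  define \<delta> where "\<delta> = r / norm (x - a)"
  have "\<delta> > 0" using False \<open>r > 0\<close> by (simp add: \<delta>_def)
  have "(\<Sum>i\<le>n. c i * t ^ i) = 0" if "0 < t" "t < \<delta>" for t
  proof -
    have "t * norm (x - a) < r"
      using that False by (simp add: \<delta>_def pos_less_divide_eq)
    then have "g t \<in> ball a r"
      using that by (simp add: g_def dist_norm)
    then show ?thesis using zero c by (metis comp_apply)
  qed
  then have "{0<..<\<delta>} \<subseteq> {t. (\<Sum>i\<le>n. c i * t ^ i) = 0}" by auto
  moreover have "infinite {0<..<\<delta>}" using \<open>\<delta> > 0\<close> by (rule infinite_Ioo)
  ultimately have "infinite {t. (\<Sum>i\<le>n. c i * t ^ i) = 0}" using finite_subset by blast
  then have "\<And>i. i \<le> n \<Longrightarrow> c i = 0" using polyfun_finite_roots[of c n] by blast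
  then have "(p \<circ> g) 1 = 0" unfolding c by simp
  then show ?thesis by (simp add: g_def)
qed

section \<open>Polynomial spaces as spans of monomials\<close>

definition monomial :: "('n::finite \<Rightarrow> nat) \<Rightarrow> real^'n \<Rightarrow> real" where
  "monomial \<alpha> x = (\<Prod>i\<in>UNIV. (x $ i) ^ \<alpha> i)"

abbreviation exponents :: "nat \<Rightarrow> ('n::finite \<Rightarrow> nat) set" where
  "exponents k \<equiv> {\<alpha>. sum \<alpha> UNIV \<le> k}"

text \<open>Each single exponent is bounded by the total degree.\<close>

lemma finite_exponents: "finite (exponents k :: ('n::finite \<Rightarrow> nat) set)"
proof (rule finite_subset)
  show "exponents k \<subseteq> (\<Pi>\<^sub>E i\<in>(UNIV::'n set). {..k})"
  proof
    fix \<alpha> :: "'n \<Rightarrow> nat" assume "\<alpha> \<in> exponents k"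
    moreover have "\<alpha> i \<le> sum \<alpha> UNIV" for i by (rule member_le_sum) auto
    ultimately show "\<alpha> \<in> (\<Pi>\<^sub>E i\<in>UNIV. {..k})" by (auto intro: order_trans)
  qed
qed (simp add: finite_PiE)

lemma Pk_eq_lin_span: "Pk k = lin_span monomial (exponents k)"
  unfolding Pk_def lin_span_def monomial_def by simp

lemma lincomb_closed_Pk: "lincomb_closed (Pk k)"
  unfolding Pk_eq_lin_span by (rule lincomb_closed_lin_span)

lemma real_polynomial_function_monomial: "real_polynomial_function (monomial \<alpha>)"
proof -
  have "real_polynomial_function (\<lambda>x::real^'a. \<Prod>i\<in>UNIV. (x $ i) ^ \<alpha> i)"
    by (intro real_polynomial_function_prod real_polynomial_function_power
        real_polynomial_function.intros(1) bounded_linear_vec_nth) simp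
  then show ?thesis unfolding monomial_def by simp
qed

lemma real_polynomial_function_Pk:
  assumes "p \<in> Pk k"
  shows "real_polynomial_function p"
proof -
  obtain c where "p = (\<lambda>x. \<Sum>\<alpha>\<in>exponents k. c \<alpha> *\<^sub>R monomial \<alpha> x)"
    using assms unfolding Pk_eq_lin_span lin_span_def by blast
  then show ?thesis
    by (auto intro!: real_polynomial_function_sum finite_exponents real_polynomial_function.intros(4)
        real_polynomial_function.intros(2) real_polynomial_function_monomial)
qed

definition face_monomial :: "(real^'n) set \<Rightarrow> ('n::finite \<Rightarrow> nat) \<Rightarrow> real^'n \<Rightarrow> real" where
  "face_monomial e \<alpha> x = (if x \<in> e then monomial \<alpha> x else 0)"

lemma Pf_eq_lin_span: "Pf k e = lin_span (face_monomial e) (exponents k)"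
proof -
  have cut: "(\<lambda>x. if x \<in> e then \<Sum>\<alpha>\<in>exponents k. c \<alpha> *\<^sub>R monomial \<alpha> x else 0)
      = (\<lambda>x. \<Sum>\<alpha>\<in>exponents k. c \<alpha> *\<^sub>R face_monomial e \<alpha> x)" for c :: "('a \<Rightarrow> nat) \<Rightarrow> real"
    by (auto simp: face_monomial_def)
  have "Pf k e = {u. \<exists>c. u = (\<lambda>x. if x \<in> e then \<Sum>\<alpha>\<in>exponents k. c \<alpha> *\<^sub>R monomial \<alpha> x else 0)}"
    unfolding Pf_def Pk_eq_lin_span lin_span_def by fastforce
  then show ?thesis unfolding cut lin_span_def .
qed

text \<open>The generators are the scalar monomials placed in each coordinate direction, so they are
  indexed by pairs.\<close>

lemma Pfv_eq_lin_span:
  fixes e :: "(real^'n) set"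
  shows "Pfv k e = lin_span (\<lambda>(i, \<alpha>) x. face_monomial e \<alpha> x *\<^sub>R axis i 1) (UNIV \<times> exponents k)"
proof -
  \<comment> \<open>Component \<open>i\<close> keeps exactly the generators of direction
    \<open>i\<close>, which reduces both inclusions to the scalar space.\<close>
  have comb: "(\<Sum>(j, \<alpha>)\<in>UNIV \<times> exponents k. c (j, \<alpha>) *\<^sub>R (face_monomial e \<alpha> x *\<^sub>R axis j 1)) $ i
      = (\<Sum>\<alpha>\<in>exponents k. c (i, \<alpha>) *\<^sub>R face_monomial e \<alpha> x)"
    for c :: "'n \<times> ('n \<Rightarrow> nat) \<Rightarrow> real" and x i
  proof -
    have "(\<Sum>(j, \<alpha>)\<in>UNIV \<times> exponents k. c (j, \<alpha>) *\<^sub>R (face_monomial e \<alpha> x *\<^sub>R axis j 1)) $ i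
       = (\<Sum>j\<in>UNIV. \<Sum>\<alpha>\<in>exponents k. if j = i then c (j, \<alpha>) *\<^sub>R face_monomial e \<alpha> x else 0)"
      by (auto simp: sum.cartesian_product[symmetric] axis_def intro!: sum.cong)
    also have "\<dots> = (\<Sum>j\<in>UNIV. if j = i then \<Sum>\<alpha>\<in>exponents k. c (j, \<alpha>) *\<^sub>R face_monomial e \<alpha> x else 0)"
      by (intro sum.cong) auto
    finally show ?thesis by simp
  qed
  show ?thesis
  proof (intro set_eqI iffI)
    fix u :: "real^'n \<Rightarrow> real^'n" assume "u \<in> Pfv k e"
    then have "\<forall>i. \<exists>c. (\<lambda>x. u x $ i) = (\<lambda>x. \<Sum>\<alpha>\<in>exponents k. c \<alpha> *\<^sub>R face_monomial e \<alpha> x)"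
      unfolding Pfv_def Pf_eq_lin_span lin_span_def by simp
    then obtain c where c: "\<And>i. (\<lambda>x. u x $ i) = (\<lambda>x. \<Sum>\<alpha>\<in>exponents k. c i \<alpha> *\<^sub>R face_monomial e \<alpha> x)"
      by metis
    have "u x $ i = (\<Sum>(j, \<alpha>)\<in>UNIV \<times> exponents k.
        c j \<alpha> *\<^sub>R (face_monomial e \<alpha> x *\<^sub>R axis j 1)) $ i" for x i
      using comb[of "\<lambda>(j, \<alpha>). c j \<alpha>" x i] fun_cong[OF c[of i], of x] by simp
    then have "u = (\<lambda>x. \<Sum>(j, \<alpha>)\<in>UNIV \<times> exponents k. c j \<alpha> *\<^sub>R (face_monomial e \<alpha> x *\<^sub>R axis j 1))"
      by (simp add: vec_eq_iff fun_eq_iff)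
    then show "u \<in> lin_span (\<lambda>(i, \<alpha>) x. face_monomial e \<alpha> x *\<^sub>R axis i 1) (UNIV \<times> exponents k)"
      unfolding lin_span_def
      by (intro CollectI exI[of _ "\<lambda>(j, \<alpha>). c j \<alpha>"]) (simp add: case_prod_beta)
  next
    fix u :: "real^'n \<Rightarrow> real^'n" assume "u \<in> lin_span (\<lambda>(i, \<alpha>) x. face_monomial e \<alpha> x *\<^sub>R axis i 1) (UNIV \<times> exponents k)"
    then obtain c :: "'n \<times> ('n \<Rightarrow> nat) \<Rightarrow> real" where "u = (\<lambda>x. \<Sum>(j, \<alpha>)\<in>UNIV \<times> exponents k.
        c (j, \<alpha>) *\<^sub>R (face_monomial e \<alpha> x *\<^sub>R axis j 1))"
      unfolding lin_span_def by (auto simp: case_prod_beta)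
    then have "(\<lambda>x. u x $ i) = (\<lambda>x. \<Sum>\<alpha>\<in>exponents k. c (i, \<alpha>) *\<^sub>R face_monomial e \<alpha> x)" for i
      using comb[of c _ i] by (simp add: fun_eq_iff)
    then show "u \<in> Pfv k e"
      unfolding Pfv_def Pf_eq_lin_span lin_span_def by fast
  qed
qed

lemma lincomb_closed_Pf: "lincomb_closed (Pf k e)"
  unfolding Pf_eq_lin_span by (rule lincomb_closed_lin_span)

lemma lincomb_closed_Pfv: "lincomb_closed (Pfv k e)"
  unfolding Pfv_eq_lin_span by (rule lincomb_closed_lin_span)

section \<open>Integration over elements and faces\<close>

text \<open>The property of \<open>Pf\<close> and \<open>Pfv\<close> on which integration over faces
  rests. Unlike membership in these spaces, it survives multiplication by arbitrary continuous
  functions.\<close>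

definition cont_on_face :: "'a::euclidean_space set \<Rightarrow> ('a \<Rightarrow> 'b::euclidean_space) \<Rightarrow> bool" where
  "cont_on_face e u \<longleftrightarrow> (\<exists>w. continuous_on UNIV w \<and> u = (\<lambda>x. if x \<in> e then w x else 0))"

lemma cont_on_face_Pf:
  assumes "u \<in> Pf k e"
  shows "cont_on_face e u"
  using assms continuous_on_real_polynomial_function[OF real_polynomial_function_Pk]
  unfolding Pf_def cont_on_face_def by blast

lemma cont_on_face_componentwise:
  fixes u :: "real^'n \<Rightarrow> real^'n"
  assumes "\<And>i. cont_on_face e (\<lambda>x. u x $ i)"
  shows "cont_on_face e u"
proof -
  obtain w where w: "\<And>i. continuous_on UNIV (w i)" "\<And>i. (\<lambda>x. u x $ i) = (\<lambda>x. if x \<in> e then w i x else 0)"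
    using assms unfolding cont_on_face_def by metis
  have "u x $ i = (if x \<in> e then \<chi> i. w i x else 0) $ i" for x i
    using fun_cong[OF w(2)[of i], of x] by simp
  then have "u = (\<lambda>x. if x \<in> e then \<chi> i. w i x else 0)"
    by (simp add: fun_eq_iff vec_eq_iff)
  moreover have "continuous_on UNIV (\<lambda>x. \<chi> i. w i x)"
    by (intro continuous_on_vec_lambda w)
  ultimately show ?thesis unfolding cont_on_face_def by blast
qed

lemma cont_on_face_Pfv:
  assumes "u \<in> Pfv k e"
  shows "cont_on_face e u"
proof (rule cont_on_face_componentwise)
  fix i
  have "(\<lambda>x. u x $ i) \<in> Pf k e" using assms unfolding Pfv_def by blast
  then show "cont_on_face e (\<lambda>x. u x $ i)" by (rule cont_on_face_Pf)
qed

lemma cont_on_face_inner_left: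
  assumes "continuous_on UNIV g" "cont_on_face e u"
  shows "cont_on_face e (\<lambda>x. g x \<bullet> u x)"
proof -
  obtain w where w: "continuous_on UNIV w" "u = (\<lambda>x. if x \<in> e then w x else 0)"
    using assms(2) unfolding cont_on_face_def by blast
  have "(\<lambda>x. g x \<bullet> u x) = (\<lambda>x. if x \<in> e then g x \<bullet> w x else 0)" using w by auto
  moreover have "continuous_on UNIV (\<lambda>x. g x \<bullet> w x)" by (intro continuous_intros assms w)
  ultimately show ?thesis unfolding cont_on_face_def by blast
qed

text \<open>Off \<open>e\<close> the factor \<open>u\<close> vanishes, so \<open>v\<close> may be
  replaced by its continuous extension.\<close>

lemma cont_on_face_inner:
  assumes "cont_on_face e v" "cont_on_face e u"
  shows "cont_on_face e (\<lambda>x. v x \<bullet> u x)"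
proof -
  obtain w where w: "continuous_on UNIV w" "v = (\<lambda>x. if x \<in> e then w x else 0)"
    using assms(1) unfolding cont_on_face_def by blast
  have "(\<lambda>x. v x \<bullet> u x) = (\<lambda>x. w x \<bullet> u x)"
    using w assms(2) unfolding cont_on_face_def by fastforce
  then show ?thesis using cont_on_face_inner_left[OF w(1) assms(2)] by simp
qed

section \<open>Integrals of continuous functions over compact sets\<close>

lemma integrable_lebesgue_on_compact:
  fixes h :: "'a::euclidean_space \<Rightarrow> 'b::euclidean_space"
  assumes "compact S" "continuous_on S h"
  shows "integrable (lebesgue_on S) h"
proof -
  have S: "S \<in> lmeasurable" by (rule lmeasurable_compact[OF assms(1)])
  interpret finite_measure "lebesgue_on S" by (rule finite_measure_lebesgue_on[OF S])
  have "bounded (h ` S)"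
    by (intro compact_imp_bounded compact_continuous_image assms)
  then obtain B where "\<And>x. x \<in> S \<Longrightarrow> norm (h x) \<le> B" unfolding bounded_iff by blast
  moreover have "h \<in> borel_measurable (lebesgue_on S)"
    using assms S by (intro continuous_imp_measurable_on_sets_lebesgue) auto
  ultimately show ?thesis
    by (intro integrable_const_bound[where B = B]) auto
qed

text \<open>Inside \<open>S\<close> the nonzero set is open and null, hence empty, and continuity
  extends the zero to the closure. The closure matters: a face is the base of its prism and has no
  points in the interior.\<close>

lemma eq_0_on_interior_if_integral_eq_0:
  fixes h :: "'a::euclidean_space \<Rightarrow> real"
  assumes S: "compact S" and h: "continuous_on UNIV h" "\<And>x. h x \<ge> 0"
    and int: "integral\<^sup>L (lebesgue_on S) h = 0" and x: "x \<in> closure (interior S)"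
  shows "h x = 0"
proof -
  have "integrable (lebesgue_on S) h"
    using integrable_lebesgue_on_compact[OF S] h continuous_on_subset by blast
  then have "AE x in lebesgue_on S. h x = 0"
    using int h by (subst (asm) integral_nonneg_eq_0_iff_AE) auto
  moreover have "S \<in> sets lebesgue" using lmeasurable_compact[OF S] by auto
  ultimately have AE: "AE x in lebesgue. x \<in> S \<longrightarrow> h x = 0"
    by (simp add: AE_restrict_space_iff)
  let ?N = "{x. h x \<noteq> 0} \<inter> interior S"
  have "open ?N"
    using h(1) by (intro open_Int open_interior open_Collect_neq) auto
  moreover have "negligible ?N"
  proof -
    have "AE x in lebesgue. x \<notin> ?N"
      using AE by eventually_elim (use interior_subset in auto)
    moreover have "?N \<in> sets lebesgue" using \<open>open ?N\<close> by (simp add: borel_open)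
    ultimately show ?thesis
      unfolding negligible_iff_null_sets by (simp add: AE_iff_null_sets)
  qed
  ultimately have "?N = {}" using open_not_negligible by blast
  then have "interior S \<subseteq> {x. h x = 0}" by auto
  moreover have "closed {x. h x = 0}" using h(1) by (intro closed_Collect_eq) auto
  ultimately show ?thesis using x closure_minimal by blast
qed

section \<open>The prism behind the surface measure\<close>

definition prism :: "'a::euclidean_space set \<Rightarrow> 'a \<Rightarrow> 'a set" where
  "prism e n = {x + t *\<^sub>R n | x t. x \<in> e \<and> t \<in> {0..1}}"

lemma prism_eq_image: "prism e n = (\<lambda>(x, t). x + t *\<^sub>R n) ` (e \<times> {0..1})"
  unfolding prism_def by force

lemma compact_prism: "compact e \<Longrightarrow> compact (prism e n)"
  unfolding prism_eq_image
  by (intro compact_continuous_image compact_Times) (auto simp: case_prod_beta intro!: continuous_intros)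

lemma polytopal_compact: "polytopal m e \<Longrightarrow> compact e"
  unfolding polytopal_def by (metis compact_Union polytope_imp_compact)

text \<open>The prism over a convex base is convex and of full dimension, so its interior is dense
  in it.\<close>

lemma polytope_subset_closure_interior_prism:
  fixes K :: "'a::euclidean_space set"
  assumes K: "polytope K" "aff_dim K = int DIM('a) - 1" and n: "is_unit_normal K n"
  shows "K \<subseteq> closure (interior (prism K n))"
proof -
  have "K \<noteq> {}" using K(2) by auto
  then obtain a where a: "a \<in> K" by blast
  have KP: "K \<subseteq> prism K n"
    unfolding prism_def by (force intro: exI[of _ 0])
  \<comment> \<open>A point of the prism off the hyperplane of \<open>K\<close>: it raises the
    affine dimension by one, to that of the space.\<close>
  have "a + n \<in> prism K n"
    unfolding prism_def using a by (intro CollectI exI[of _ a] exI[of _ 1]) auto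
  have "convex {x. n \<bullet> x = n \<bullet> a}" "affine {x. n \<bullet> x = n \<bullet> a}"
    by (rule convex_hyperplane affine_hyperplane)+
  moreover have "K \<subseteq> {x. n \<bullet> x = n \<bullet> a}"
  proof
    fix x assume "x \<in> K"
    then have "(x - a) \<bullet> n = 0" using n a unfolding is_unit_normal_def by blast
    then show "x \<in> {x. n \<bullet> x = n \<bullet> a}" by (simp add: inner_diff_left inner_commute[of n])
  qed
  ultimately have hull: "affine hull K \<subseteq> {x. n \<bullet> x = n \<bullet> a}" by (simp add: hull_minimal)
  have "n \<bullet> n = 1" using n unfolding is_unit_normal_def by (simp add: norm_eq_1)
  then have "a + n \<notin> affine hull K" using hull by (auto simp: inner_add_right)
  then have "affine hull K \<subset> affine hull prism K n"
    using \<open>a + n \<in> prism K n\<close> KP by (metis hull_inc hull_mono psubsetI)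
  then have "aff_dim K < aff_dim (prism K n)" by (rule aff_dim_psubset)
  then have "aff_dim (prism K n) = int DIM('a)"
    using K(2) aff_dim_le_DIM[of "prism K n"] by linarith
  moreover have "convex (prism K n)"
  proof -
    \<comment> \<open>The prism is the Minkowski sum of \<open>K\<close> and a segment.\<close>
    have "prism K n = (\<Union>x\<in>K. \<Union>y\<in>(\<lambda>t. t *\<^sub>R n) ` {0..1}. {x + y})"
      unfolding prism_def by blast
    moreover have "convex ((\<lambda>t. t *\<^sub>R n) ` {0..1::real})"
      by (intro convex_linear_image) (auto simp: bounded_linear.linear bounded_linear_scaleR_left)
    ultimately show ?thesis
      using convex_sums[OF polytope_imp_convex[OF K(1)]] by metis
  qed
  ultimately have "interior (prism K n) \<noteq> {}"
    using rel_interior_eq_empty[of "prism K n"] KP \<open>K \<noteq> {}\<close> by (auto simp: interior_rel_interior_gen)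
  then have "closure (interior (prism K n)) = closure (prism K n)"
    using convex_closure_interior \<open>convex (prism K n)\<close> by blast
  then show ?thesis using KP closure_subset by blast
qed

text \<open>A face may be nonconvex, but its convex pieces have its dimension and inherit its
  normal, so each piece is covered by the interior closure of its own prism.\<close>

lemma face_subset_closure_interior_prism:
  fixes e :: "'a::euclidean_space set"
  assumes e: "polytopal (int DIM('a) - 1) e" and n: "is_unit_normal e n"
  shows "e \<subseteq> closure (interior (prism e n))"
proof
  fix x assume "x \<in> e"
  then obtain K where K: "polytope K" "aff_dim K = int DIM('a) - 1" "x \<in> K" "K \<subseteq> e"
    using e unfolding polytopal_def by blast
  have "is_unit_normal K n" using n K(4) unfolding is_unit_normal_def by blast
  then have "x \<in> closure (interior (prism K n))"
    using polytope_subset_closure_interior_prism K by blast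
  moreover have "prism K n \<subseteq> prism e n" using K(4) unfolding prism_def by blast
  ultimately show "x \<in> closure (interior (prism e n))"
    using closure_mono interior_mono by blast
qed

text \<open>Hides the chosen normal and base point: what remains is a continuous map collapsing each
  normal segment to its foot.\<close>

lemma surface_eq_distr:
  assumes "e \<noteq> {}" "is_unit_normal e n0"
  obtains n pr where "is_unit_normal e n" "continuous_on UNIV pr"
    "\<And>x t. x \<in> e \<Longrightarrow> pr (x + t *\<^sub>R n) = x" "surface e = distr (lebesgue_on (prism e n)) borel pr"
proof -
  define n where "n = (SOME n. is_unit_normal e n)"
  define a where "a = (SOME a. a \<in> e)"
  have n: "is_unit_normal e n" unfolding n_def using assms(2) by (rule someI)
  have a: "a \<in> e" unfolding a_def using assms(1) by (simp add: some_in_eq)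
  let ?pr = "\<lambda>y. y - ((y - a) \<bullet> n) *\<^sub>R n"
  have "?pr (x + t *\<^sub>R n) = x" if "x \<in> e" for x t
  proof -
    have "(x - a) \<bullet> n = 0" "n \<bullet> n = 1"
      using n a that unfolding is_unit_normal_def by (auto simp: norm_eq_1)
    then have "(x + t *\<^sub>R n - a) \<bullet> n = t" by (simp add: inner_diff_left inner_add_left)
    then show ?thesis by simp
  qed
  moreover have "continuous_on UNIV ?pr" by (intro continuous_intros)
  moreover have "surface e = distr (lebesgue_on (prism e n)) borel ?pr"
    unfolding surface_def Let_def prism_def n_def a_def ..
  ultimately show ?thesis using n that by blast
qed

locale flat_face =
  fixes e :: "'a::euclidean_space set"
  assumes polytopal: "polytopal (int DIM('a) - 1) e" and normal_ex: "\<exists>n. is_unit_normal e n"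
begin

lemma face_nonempty: "e \<noteq> {}"
  using polytopal unfolding polytopal_def by auto

lemma face_compact: "compact e"
  using polytopal by (rule polytopal_compact)

lemma face_surface:
  obtains n pr where "is_unit_normal e n" "continuous_on UNIV pr"
    "\<And>x. x \<in> prism e n \<Longrightarrow> pr x \<in> e" "\<And>x. x \<in> e \<Longrightarrow> pr x = x"
    "surface e = distr (lebesgue_on (prism e n)) borel pr" "pr \<in> borel_measurable (lebesgue_on (prism e n))"
proof -
  obtain n0 where "is_unit_normal e n0" using normal_ex by blast
  obtain n pr where *: "is_unit_normal e n" "continuous_on UNIV pr"
    "\<And>x t. x \<in> e \<Longrightarrow> pr (x + t *\<^sub>R n) = x" "surface e = distr (lebesgue_on (prism e n)) borel pr"
    using surface_eq_distr[OF face_nonempty \<open>is_unit_normal e n0\<close>] by metis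
  have "pr x = x" if "x \<in> e" for x using *(3)[OF that, of 0] by simp
  moreover have "pr x \<in> e" if "x \<in> prism e n" for x
    using that *(3) unfolding prism_def by force
  moreover have "pr \<in> borel_measurable (lebesgue_on (prism e n))"
    using *(2) lmeasurable_compact[OF compact_prism[OF face_compact, of n]]
    by (intro continuous_imp_measurable_on_sets_lebesgue) (auto intro: continuous_on_subset)
  ultimately show ?thesis using * that by blast
qed

lemma cont_on_face_borel_measurable:
  assumes "cont_on_face e h"
  shows "h \<in> borel_measurable borel"
proof -
  obtain w where w: "continuous_on UNIV w" "h = (\<lambda>x. if x \<in> e then w x else 0)"
    using assms unfolding cont_on_face_def by blast
  have "h = (\<lambda>x. indicator e x *\<^sub>R w x)" using w(2) by (auto simp: indicator_def)
  then show ?thesis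
    using borel_measurable_continuous_on_indicator[of e w] continuous_on_subset[OF w(1), of e]
      compact_imp_closed[OF face_compact] by simp
qed

text \<open>On the prism \<open>pr\<close> takes values in \<open>e\<close>, so the jump of
  \<open>h\<close> at the edge of the face disappears after composition, and a continuous function
  on a compact set is left.\<close>

lemma integrable_surface:
  assumes "cont_on_face e h"
  shows "integrable (surface e) h"
proof -
  obtain n pr where *: "continuous_on UNIV pr" "\<And>x. x \<in> prism e n \<Longrightarrow> pr x \<in> e"
    "surface e = distr (lebesgue_on (prism e n)) borel pr"
    "pr \<in> borel_measurable (lebesgue_on (prism e n))"
    using face_surface by metis
  obtain w where w: "continuous_on UNIV w" "h = (\<lambda>x. if x \<in> e then w x else 0)"
    using assms unfolding cont_on_face_def by blast
  have "integrable (lebesgue_on (prism e n)) (\<lambda>x. w (pr x))"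
    using *(1) w(1) by (intro integrable_lebesgue_on_compact compact_prism face_compact)
      (metis continuous_on_compose2 continuous_on_subset subset_UNIV)
  moreover have "integrable (lebesgue_on (prism e n)) (\<lambda>x. w (pr x))
      \<longleftrightarrow> integrable (lebesgue_on (prism e n)) (\<lambda>x. h (pr x))"
    by (rule Bochner_Integration.integrable_cong) (use w(2) *(2) in auto)
  ultimately show ?thesis
    unfolding *(3) using cont_on_face_borel_measurable[OF assms] by (subst integrable_distr_eq[OF *(4)]) auto
qed

text \<open>Pulled back to the prism, the integrand is continuous and nonnegative, so it vanishes up
  to the base, where \<open>pr\<close> is the identity. Off the face \<open>u\<close> is zero by its
  form.\<close>

lemma integral_surface_eq_0_imp:
  assumes "cont_on_face e u" "vip (surface e) u u = 0"
  shows "u = (\<lambda>_. 0)"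
proof -
  obtain n pr where *: "is_unit_normal e n" "continuous_on UNIV pr" "\<And>x. x \<in> prism e n \<Longrightarrow> pr x \<in> e"
    "\<And>x. x \<in> e \<Longrightarrow> pr x = x" "surface e = distr (lebesgue_on (prism e n)) borel pr"
    "pr \<in> borel_measurable (lebesgue_on (prism e n))"
    using face_surface by metis
  obtain w where w: "continuous_on UNIV w" "u = (\<lambda>x. if x \<in> e then w x else 0)"
    using assms unfolding cont_on_face_def by blast
  have uu: "(\<lambda>x. u x \<bullet> u x) \<in> borel_measurable borel"
    by (intro cont_on_face_borel_measurable cont_on_face_inner assms)
  have "integral\<^sup>L (lebesgue_on (prism e n)) (\<lambda>x. w (pr x) \<bullet> w (pr x))
      = integral\<^sup>L (lebesgue_on (prism e n)) (\<lambda>x. u (pr x) \<bullet> u (pr x))"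
    by (rule Bochner_Integration.integral_cong) (use w(2) *(3) in auto)
  also have "\<dots> = vip (surface e) u u"
    unfolding vip_def *(5) by (rule integral_distr[OF *(6) uu, symmetric])
  finally have "integral\<^sup>L (lebesgue_on (prism e n)) (\<lambda>x. w (pr x) \<bullet> w (pr x)) = 0"
    using assms(2) by simp
  moreover have "continuous_on UNIV (\<lambda>x. w (pr x) \<bullet> w (pr x))"
    using *(2) w(1) by (intro continuous_intros) (metis continuous_on_compose2 subset_UNIV)+
  ultimately have "w (pr x) \<bullet> w (pr x) = 0" if "x \<in> e" for x
    using face_subset_closure_interior_prism[OF polytopal *(1)] that
    by (intro eq_0_on_interior_if_integral_eq_0[OF compact_prism[OF face_compact]]) auto
  then show ?thesis using w(2) *(4) by auto
qed

lemma l2_space_surface: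
  assumes "V = lin_span m I" "finite I" "\<And>u. u \<in> V \<Longrightarrow> cont_on_face e u"
  shows "l2_space (surface e) V"
proof
  show "\<exists>m (n::nat). V = lin_span m {..<n}"
    unfolding assms(1) by (rule lin_span_reindex_nat[OF assms(2)])
qed (auto intro: integrable_surface cont_on_face_inner assms(3) dest: assms(3) integral_surface_eq_0_imp)

end

section \<open>The concrete spaces as instances of \<open>l2_space\<close>\<close>

lemma l2_space_Pf:
  fixes e :: "(real^'n) set"
  assumes "flat_face e"
  shows "l2_space (surface e) (Pf k e)"
  using assms by (intro flat_face.l2_space_surface[OF _ Pf_eq_lin_span] finite_exponents cont_on_face_Pf)

lemma l2_space_Pfv:
  fixes e :: "(real^'n) set"
  assumes "flat_face e"
  shows "l2_space (surface e) (Pfv k e)"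
  by (rule flat_face.l2_space_surface[OF assms Pfv_eq_lin_span])
    (simp_all add: finite_exponents cont_on_face_Pfv)

text \<open>Members are polynomials on the whole space, so vanishing on the element has to be
  propagated beyond it; a ball in the nonempty interior does this.\<close>

lemma l2_space_Pk:
  fixes T :: "(real^'n) set"
  assumes T: "compact T" "interior T \<noteq> {}"
  shows "l2_space (lebesgue_on T) (Pk k :: (real^'n \<Rightarrow> real) set)"
proof
  show "\<exists>m (n::nat). (Pk k :: (real^'n \<Rightarrow> real) set) = lin_span m {..<n}"
    unfolding Pk_eq_lin_span by (rule lin_span_reindex_nat[OF finite_exponents])
next
  fix u v :: "real^'n \<Rightarrow> real" assume "u \<in> Pk k" "v \<in> Pk k"
  then show "integrable (lebesgue_on T) (\<lambda>x. u x \<bullet> v x)"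
    by (intro integrable_lebesgue_on_compact T(1) continuous_intros
        continuous_on_real_polynomial_function real_polynomial_function_Pk)
next
  fix u :: "real^'n \<Rightarrow> real" assume u: "u \<in> Pk k" "vip (lebesgue_on T) u u = 0"
  have poly: "real_polynomial_function u" by (rule real_polynomial_function_Pk[OF u(1)])
  obtain a r where ar: "r > 0" "ball a r \<subseteq> interior T"
    using T(2) open_contains_ball[of "interior T"] by blast
  have cont: "continuous_on UNIV (\<lambda>x. u x \<bullet> u x)"
    by (intro continuous_on_inner continuous_on_real_polynomial_function poly)
  have "u x \<bullet> u x = 0" if "x \<in> interior T" for x
    by (rule eq_0_on_interior_if_integral_eq_0[OF T(1) cont])
      (use u(2) that closure_subset in \<open>auto simp: vip_def\<close>)
  then have "u x = 0" if "x \<in> ball a r" for x using ar that by fastforce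
  then show "u = (\<lambda>_. 0)"
    using real_polynomial_function_eq_0_if_eq_0_on_ball[OF poly ar(1)] by blast
qed

section \<open>Linearity of gradients, pairings and face projections\<close>

lemma pd_lincomb_polynomial:
  assumes "real_polynomial_function p" "real_polynomial_function q"
  shows "pd i (\<lambda>x. c * p x + q x) = (\<lambda>x. c * pd i p x + pd i q x)"
  using assms by (auto intro!: pd_lincomb differentiable_at_real_polynomial_function)

lemma grad_lincomb_polynomial:
  assumes "real_polynomial_function p" "real_polynomial_function q"
  shows "grad (\<lambda>x. c * p x + q x) = (\<lambda>x. c *\<^sub>R grad p x + grad q x)"
  unfolding grad_def using pd_lincomb_polynomial[OF assms] by (simp add: vec_eq_iff fun_eq_iff)

lemma continuous_on_grad_polynomial:
  "real_polynomial_function p \<Longrightarrow> continuous_on UNIV (grad p)"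
  unfolding grad_def
  by (intro continuous_on_vec_lambda continuous_on_real_polynomial_function real_polynomial_function_pd)

lemma ip_commute: "ip M u v = ip M v u"
  unfolding ip_eq_vip by (rule vip_commute)

lemma ip_lincomb_left:
  assumes "integrable M (\<lambda>x. u x * w x)" "integrable M (\<lambda>x. v x * w x)"
  shows "ip M (\<lambda>x. c * u x + v x) w = c * ip M u w + ip M v w"
  using vip_lincomb_left[of M u w v c] assms unfolding ip_eq_vip by simp

lemma ip_lincomb_right:
  assumes "integrable M (\<lambda>x. w x * u x)" "integrable M (\<lambda>x. w x * v x)"
  shows "ip M w (\<lambda>x. c * u x + v x) = c * ip M w u + ip M w v"
  using vip_lincomb_right[of M w u v c] assms unfolding ip_eq_vip by simp

lemma sum_lincomb:
  fixes c :: real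
  assumes "\<And>e. e \<in> E \<Longrightarrow> f e = c * g e + h e"
  shows "sum f E = c * sum g E + sum h E"
  using assms by (simp add: sum.distrib sum_distrib_left)

lemma Qb_eq_riesz:
  fixes e :: "(real^'n) set"
  assumes "flat_face e"
  shows "Qb k e g = l2_space.riesz (surface e) (Pf (k - 2) e) (ip (surface e) g)"
proof -
  interpret l2_space "surface e" "Pf (k - 2) e" by (rule l2_space_Pf[OF assms])
  show ?thesis unfolding Qb_def riesz_def ip_eq_vip ..
qed

lemma Qbv_eq_riesz:
  fixes e :: "(real^'n) set"
  assumes "flat_face e"
  shows "Qbv k e g = l2_space.riesz (surface e) (Pfv (k - 2) e) (vip (surface e) g)"
proof -
  interpret l2_space "surface e" "Pfv (k - 2) e" by (rule l2_space_Pfv[OF assms])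
  show ?thesis unfolding Qbv_def riesz_def ..
qed

context flat_face
begin

lemma integrable_surface_inner:
  "continuous_on UNIV g \<Longrightarrow> cont_on_face e u \<Longrightarrow> integrable (surface e) (\<lambda>x. g x \<bullet> u x)"
  by (intro integrable_surface cont_on_face_inner_left)

lemma vip_lincomb_surface_left:
  assumes "continuous_on UNIV g" "continuous_on UNIV h" "cont_on_face e u"
  shows "vip (surface e) (\<lambda>x. c *\<^sub>R g x + h x) u = c * vip (surface e) g u + vip (surface e) h u"
  using assms by (intro vip_lincomb_left integrable_surface_inner)

lemma vip_lincomb_surface_right:
  assumes "continuous_on UNIV g" "cont_on_face e u" "cont_on_face e v"
  shows "vip (surface e) g (\<lambda>x. c *\<^sub>R u x + v x) = c * vip (surface e) g u + vip (surface e) g v"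
  using assms by (intro vip_lincomb_right integrable_surface_inner)

end

context
  fixes e :: "(real^'n) set"
  assumes e: "flat_face e"
begin

lemma linear_form_ip_surface:
  assumes "continuous_on UNIV g"
  shows "linear_form (Pf m e) (ip (surface e) g)"
  unfolding linear_form_def ip_eq_vip
  using flat_face.vip_lincomb_surface_right[OF e assms] cont_on_face_Pf by blast

lemma linear_form_vip_surface:
  assumes "continuous_on UNIV g"
  shows "linear_form (Pfv m e) (vip (surface e) g)"
  unfolding linear_form_def
  using flat_face.vip_lincomb_surface_right[OF e assms] cont_on_face_Pfv by blast

lemma Qb_in_Pf: "continuous_on UNIV g \<Longrightarrow> Qb k e g \<in> Pf (k - 2) e"
  unfolding Qb_eq_riesz[OF e] by (intro l2_space.riesz_in l2_space_Pf linear_form_ip_surface e)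

lemma Qbv_in_Pfv: "continuous_on UNIV g \<Longrightarrow> Qbv k e g \<in> Pfv (k - 2) e"
  unfolding Qbv_eq_riesz[OF e] by (intro l2_space.riesz_in l2_space_Pfv linear_form_vip_surface e)

lemma Qb_lincomb:
  assumes g: "continuous_on UNIV g" and h: "continuous_on UNIV h"
  shows "Qb k e (\<lambda>x. c * g x + h x) = (\<lambda>x. c * Qb k e g x + Qb k e h x)"
proof -
  have "continuous_on UNIV (\<lambda>x. c * g x + h x)" by (intro continuous_intros g h)
  note gh = linear_form_ip_surface[OF this, of "k - 2"]
  have "ip (surface e) (\<lambda>x. c * g x + h x) \<phi> = c * ip (surface e) g \<phi> + ip (surface e) h \<phi>"
    if "\<phi> \<in> Pf (k - 2) e" for \<phi>
    using flat_face.vip_lincomb_surface_left[OF e g h cont_on_face_Pf[OF that], of c]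
    by (simp add: ip_eq_vip)
  from l2_space.riesz_lincomb[OF l2_space_Pf[OF e] linear_form_ip_surface[OF g]
      linear_form_ip_surface[OF h] gh this]
  show ?thesis unfolding Qb_eq_riesz[OF e] by simp
qed

lemma Qbv_lincomb:
  assumes g: "continuous_on UNIV g" and h: "continuous_on UNIV h"
  shows "Qbv k e (\<lambda>x. c *\<^sub>R g x + h x) = (\<lambda>x. c *\<^sub>R Qbv k e g x + Qbv k e h x)"
proof -
  have "continuous_on UNIV (\<lambda>x. c *\<^sub>R g x + h x)" by (intro continuous_intros g h)
  note gh = linear_form_vip_surface[OF this, of "k - 2"]
  have "vip (surface e) (\<lambda>x. c *\<^sub>R g x + h x) \<phi> = c * vip (surface e) g \<phi> + vip (surface e) h \<phi>"
    if "\<phi> \<in> Pfv (k - 2) e" for \<phi>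
    by (rule flat_face.vip_lincomb_surface_left[OF e g h cont_on_face_Pfv[OF that]])
  from l2_space.riesz_lincomb[OF l2_space_Pfv[OF e] linear_form_vip_surface[OF g]
      linear_form_vip_surface[OF h] gh this]
  show ?thesis unfolding Qbv_eq_riesz[OF e] .
qed

end

text \<open>One convex piece of full dimension already has interior points.\<close>

lemma polytopal_interior_nonempty:
  fixes T :: "'a::euclidean_space set"
  assumes "polytopal (int DIM('a)) T"
  shows "interior T \<noteq> {}"
proof -
  have "T \<noteq> {}" using assms unfolding polytopal_def by auto
  then obtain K where K: "polytope K" "aff_dim K = int DIM('a)" "K \<subseteq> T"
    using assms unfolding polytopal_def by blast
  have "K \<noteq> {}" using K(2) by auto
  then have "interior K \<noteq> {}"
    using K(2) rel_interior_eq_empty[OF polytope_imp_convex[OF K(1)]] by (simp add: interior_rel_interior_gen)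
  then show ?thesis using interior_mono[OF K(3)] by blast
qed

lemma face_space_lincomb:
  assumes "(b, g) \<in> face_space k E" "(b', g') \<in> face_space k E"
  shows "(\<lambda>e x. c * b e x + b' e x, \<lambda>e x. c *\<^sub>R g e x + g' e x) \<in> face_space k E"
  using assms lincomb_closed_lincomb[OF lincomb_closed_Pf] lincomb_closed_lincomb[OF lincomb_closed_Pfv]
  unfolding face_space_def by fastforce

lemma face_space_zero: "(\<lambda>_ _. 0, \<lambda>_ _. 0) \<in> face_space k E"
  unfolding face_space_def
  using lincomb_closed_zero[OF lincomb_closed_Pf] lincomb_closed_zero[OF lincomb_closed_Pfv] by fast

section \<open>The local forms\<close>

definition wg_lincomb :: "real \<Rightarrow> 'n::finite local_wg \<Rightarrow> 'n local_wg \<Rightarrow> 'n local_wg" where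
  "wg_lincomb c = (\<lambda>(v0, vb, vg) (w0, wb, wg).
     (\<lambda>x. c * v0 x + w0 x, \<lambda>e x. c * vb e x + wb e x, \<lambda>e x. c *\<^sub>R vg e x + wg e x))"

text \<open>The linear functional on \<open>P\<^bsub>k-2\<^esub>(T)\<close> that the weak derivative represents.\<close>

definition d2_load ::
  "((real^'n) set \<Rightarrow> (real^'n) set set) \<Rightarrow> (real^'n) set \<Rightarrow> 'n \<Rightarrow> 'n \<Rightarrow> 'n local_wg \<Rightarrow>
   (real^'n \<Rightarrow> real) \<Rightarrow> real" where
  "d2_load F T i j = (\<lambda>(v0, vb, vg) \<phi>.
     ip (lebesgue_on T) v0 (pd j (pd i \<phi>))
     - (\<Sum>e\<in>F T. ip (surface e) (\<lambda>x. vb e x * outward_normal T e $ i) (pd j \<phi>))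
     + (\<Sum>e\<in>F T. ip (surface e) (\<lambda>x. vg e x $ i) (\<lambda>x. \<phi> x * outward_normal T e $ j)))"

definition bnd_residual :: "nat \<Rightarrow> 'n::finite local_wg \<Rightarrow> (real^'n) set \<Rightarrow> real^'n \<Rightarrow> real" where
  "bnd_residual k = (\<lambda>(v0, vb, vg) e x. Qb k e v0 x - vb e x)"

definition grad_residual :: "nat \<Rightarrow> 'n::finite local_wg \<Rightarrow> (real^'n) set \<Rightarrow> real^'n \<Rightarrow> real^'n" where
  "grad_residual k = (\<lambda>(v0, vb, vg) e x. Qbv k e (grad v0) x - vg e x)"

text \<open>The stabilizer is a nonnegatively weighted sum of pairings of residuals, each linear in
  its argument; bilinearity, symmetry and semidefiniteness are read off from this.\<close>

lemma s_form_eq: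
  "s_form F k T w v =
     inverse (diameter T) * (\<Sum>e\<in>F T. vip (surface e) (grad_residual k w e) (grad_residual k v e)) +
     inverse (diameter T ^ 3) * (\<Sum>e\<in>F T. ip (surface e) (bnd_residual k w e) (bnd_residual k v e))"
  by (simp add: s_form_def bnd_residual_def grad_residual_def split_beta)

locale wg_element =
  fixes T :: "(real^'n) set" and F :: "(real^'n) set \<Rightarrow> (real^'n) set set" and k :: nat
  assumes element: "polytopal_element T (F T)"
begin

lemma compact_T: "compact T"
  using element polytopal_compact unfolding polytopal_element_def by blast

lemma interior_T: "interior T \<noteq> {}"
  using element polytopal_interior_nonempty unfolding polytopal_element_def by blast

lemma finite_faces: "finite (F T)"
  using element unfolding polytopal_element_def by blast

lemma flat_faces: "e \<in> F T \<Longrightarrow> flat_face e"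
  using element unfolding polytopal_element_def flat_face_def is_outward_normal_def by blast

sublocale Pk: l2_space "lebesgue_on T" "Pk m :: (real^'n \<Rightarrow> real) set" for m
  by (rule l2_space_Pk[OF compact_T interior_T])

lemma integrable_T:
  fixes u v :: "real^'n \<Rightarrow> real"
  assumes "continuous_on UNIV u" "continuous_on UNIV v"
  shows "integrable (lebesgue_on T) (\<lambda>x. u x * v x)"
  using assms by (intro integrable_lebesgue_on_compact compact_T continuous_intros) (auto intro: continuous_on_subset)

text \<open>The constant \<open>s\<close> stands for a component of the outward normal.\<close>

lemma integrable_bnd_term:
  assumes "e \<in> F T" "b \<in> Pf m e" "continuous_on UNIV p"
  shows "integrable (surface e) (\<lambda>x. (b x * s) * p x)"
  using flat_face.integrable_surface_inner[OF flat_faces[OF assms(1)], of "\<lambda>x. s * p x" b]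
    cont_on_face_Pf[OF assms(2)] assms(3)
  by (simp add: ac_simps continuous_on_mult_left)

lemma W_localD:
  assumes "(v0, vb, vg) \<in> W_local F k T"
  shows "v0 \<in> Pk k" "real_polynomial_function v0" "e \<in> F T \<Longrightarrow> vb e \<in> Pf (k - 2) e"
    "e \<in> F T \<Longrightarrow> vg e \<in> Pfv (k - 2) e"
  using assms real_polynomial_function_Pk unfolding W_local_def face_space_def by auto

lemma wg_lincomb_in_W_local:
  assumes "v \<in> W_local F k T" "w \<in> W_local F k T"
  shows "wg_lincomb c v w \<in> W_local F k T"
proof -
  obtain v0 vb vg w0 wb wg where vw: "v = (v0, vb, vg)" "w = (w0, wb, wg)" by (metis prod.exhaust)
  have "(\<lambda>x. c *\<^sub>R v0 x + w0 x) \<in> Pk k"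
    using assms unfolding vw by (intro lincomb_closed_lincomb[OF lincomb_closed_Pk] W_localD(1))
  then show ?thesis
    using assms face_space_lincomb[of vb vg k "F T" wb wg c] unfolding vw W_local_def wg_lincomb_def by simp
qed

section \<open>Linearity of the weak second derivatives\<close>

lemma d2_load_lincomb_test:
  assumes v: "v \<in> W_local F k T" and \<phi>: "real_polynomial_function \<phi>" and \<psi>: "real_polynomial_function \<psi>"
  shows "d2_load F T i j v (\<lambda>x. c * \<phi> x + \<psi> x) = c * d2_load F T i j v \<phi> + d2_load F T i j v \<psi>"
proof -
  obtain v0 vb vg where vw: "v = (v0, vb, vg)" by (metis prod.exhaust)
  note W = W_localD[OF v[unfolded vw]]
  note cont = continuous_on_real_polynomial_function real_polynomial_function_pd \<phi> \<psi> W(2)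
  have pd1: "pd l (\<lambda>x. c * \<phi> x + \<psi> x) = (\<lambda>x. c * pd l \<phi> x + pd l \<psi> x)" for l
    by (rule pd_lincomb_polynomial[OF \<phi> \<psi>])
  have pd2: "pd j (pd i (\<lambda>x. c * \<phi> x + \<psi> x)) = (\<lambda>x. c * pd j (pd i \<phi>) x + pd j (pd i \<psi>) x)"
    unfolding pd1 by (intro pd_lincomb_polynomial real_polynomial_function_pd \<phi> \<psi>)
  have 1: "ip (lebesgue_on T) v0 (\<lambda>x. c * pd j (pd i \<phi>) x + pd j (pd i \<psi>) x)
    = c * ip (lebesgue_on T) v0 (pd j (pd i \<phi>)) + ip (lebesgue_on T) v0 (pd j (pd i \<psi>))"
    by (intro ip_lincomb_right integrable_T cont)
  have 2: "(\<Sum>e\<in>F T. ip (surface e) (\<lambda>x. vb e x * outward_normal T e $ i) (\<lambda>x. c * pd j \<phi> x + pd j \<psi> x))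
    = c * (\<Sum>e\<in>F T. ip (surface e) (\<lambda>x. vb e x * outward_normal T e $ i) (pd j \<phi>))
      + (\<Sum>e\<in>F T. ip (surface e) (\<lambda>x. vb e x * outward_normal T e $ i) (pd j \<psi>))"
    by (intro sum_lincomb ip_lincomb_right integrable_bnd_term[OF _ W(3)] cont)
  have 3: "(\<Sum>e\<in>F T. ip (surface e) (\<lambda>x. vg e x $ i) (\<lambda>x. (c * \<phi> x + \<psi> x) * outward_normal T e $ j))
    = c * (\<Sum>e\<in>F T. ip (surface e) (\<lambda>x. vg e x $ i) (\<lambda>x. \<phi> x * outward_normal T e $ j))
      + (\<Sum>e\<in>F T. ip (surface e) (\<lambda>x. vg e x $ i) (\<lambda>x. \<psi> x * outward_normal T e $ j))"
  proof (rule sum_lincomb)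
    fix e assume e: "e \<in> F T"
    have vgi: "(\<lambda>x. vg e x $ i) \<in> Pf (k - 2) e" using W(4)[OF e] by (simp add: Pfv_def)
    have "integrable (surface e) (\<lambda>x. vg e x $ i * (p x * outward_normal T e $ j))"
      if "continuous_on UNIV p" for p
      using integrable_bnd_term[OF e vgi that, of "outward_normal T e $ j"] by (simp add: ac_simps)
    then have "ip (surface e) (\<lambda>x. vg e x $ i) (\<lambda>x. c * (\<phi> x * outward_normal T e $ j) + \<psi> x * outward_normal T e $ j)
      = c * ip (surface e) (\<lambda>x. vg e x $ i) (\<lambda>x. \<phi> x * outward_normal T e $ j)
        + ip (surface e) (\<lambda>x. vg e x $ i) (\<lambda>x. \<psi> x * outward_normal T e $ j)"
      by (intro ip_lincomb_right) (simp_all add: cont)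
    then show "ip (surface e) (\<lambda>x. vg e x $ i) (\<lambda>x. (c * \<phi> x + \<psi> x) * outward_normal T e $ j)
      = c * ip (surface e) (\<lambda>x. vg e x $ i) (\<lambda>x. \<phi> x * outward_normal T e $ j)
        + ip (surface e) (\<lambda>x. vg e x $ i) (\<lambda>x. \<psi> x * outward_normal T e $ j)"
      by (simp add: distrib_right mult.assoc)
  qed
  show ?thesis
    unfolding vw d2_load_def prod.case pd2 1 unfolding pd1 2 3 by (simp add: algebra_simps)
qed

text \<open>Linearity in the test function makes the weak derivative exist; linearity in the WG
  function, shown here, makes it a linear operator.\<close>

lemma d2_load_wg_lincomb:
  assumes v: "v \<in> W_local F k T" and w: "w \<in> W_local F k T" and \<phi>: "real_polynomial_function \<phi>"
  shows "d2_load F T i j (wg_lincomb c v w) \<phi> = c * d2_load F T i j v \<phi> + d2_load F T i j w \<phi>"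
proof -
  obtain v0 vb vg w0 wb wg where vw: "v = (v0, vb, vg)" "w = (w0, wb, wg)" by (metis prod.exhaust)
  note V = W_localD[OF v[unfolded vw]] and W = W_localD[OF w[unfolded vw]]
  note cont = continuous_on_real_polynomial_function real_polynomial_function_pd \<phi> V(2) W(2)
  have 1: "ip (lebesgue_on T) (\<lambda>x. c * v0 x + w0 x) (pd j (pd i \<phi>))
    = c * ip (lebesgue_on T) v0 (pd j (pd i \<phi>)) + ip (lebesgue_on T) w0 (pd j (pd i \<phi>))"
    by (intro ip_lincomb_left integrable_T cont)
  have 2: "(\<Sum>e\<in>F T. ip (surface e) (\<lambda>x. (c * vb e x + wb e x) * outward_normal T e $ i) (pd j \<phi>))
    = c * (\<Sum>e\<in>F T. ip (surface e) (\<lambda>x. vb e x * outward_normal T e $ i) (pd j \<phi>))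
      + (\<Sum>e\<in>F T. ip (surface e) (\<lambda>x. wb e x * outward_normal T e $ i) (pd j \<phi>))"
    unfolding distrib_right mult.assoc[of c]
    by (intro sum_lincomb ip_lincomb_left integrable_bnd_term[OF _ V(3)] integrable_bnd_term[OF _ W(3)] cont)
  have 3: "(\<Sum>e\<in>F T. ip (surface e) (\<lambda>x. (c *\<^sub>R vg e x + wg e x) $ i) (\<lambda>x. \<phi> x * outward_normal T e $ j))
    = c * (\<Sum>e\<in>F T. ip (surface e) (\<lambda>x. vg e x $ i) (\<lambda>x. \<phi> x * outward_normal T e $ j))
      + (\<Sum>e\<in>F T. ip (surface e) (\<lambda>x. wg e x $ i) (\<lambda>x. \<phi> x * outward_normal T e $ j))"
  proof (rule sum_lincomb)
    fix e assume e: "e \<in> F T"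
    have "integrable (surface e) (\<lambda>x. g x $ i * (\<phi> x * outward_normal T e $ j))"
      if "g \<in> Pfv (k - 2) e" for g
    proof -
      have "(\<lambda>x. g x $ i) \<in> Pf (k - 2) e" using that by (simp add: Pfv_def)
      from integrable_bnd_term[OF e this, of \<phi> "outward_normal T e $ j"] show ?thesis
        by (simp add: ac_simps cont)
    qed
    then have "ip (surface e) (\<lambda>x. c * (vg e x $ i) + wg e x $ i) (\<lambda>x. \<phi> x * outward_normal T e $ j)
      = c * ip (surface e) (\<lambda>x. vg e x $ i) (\<lambda>x. \<phi> x * outward_normal T e $ j)
        + ip (surface e) (\<lambda>x. wg e x $ i) (\<lambda>x. \<phi> x * outward_normal T e $ j)"
      using V(4)[OF e] W(4)[OF e] by (intro ip_lincomb_left) blast+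
    then show "ip (surface e) (\<lambda>x. (c *\<^sub>R vg e x + wg e x) $ i) (\<lambda>x. \<phi> x * outward_normal T e $ j)
      = c * ip (surface e) (\<lambda>x. vg e x $ i) (\<lambda>x. \<phi> x * outward_normal T e $ j)
        + ip (surface e) (\<lambda>x. wg e x $ i) (\<lambda>x. \<phi> x * outward_normal T e $ j)"
      by simp
  qed
  show ?thesis
    unfolding vw d2_load_def wg_lincomb_def prod.case 1 2 3 by (simp add: algebra_simps)
qed

lemma linear_form_d2_load:
  "v \<in> W_local F k T \<Longrightarrow> linear_form (Pk m) (d2_load F T i j v)"
  unfolding linear_form_def by (simp add: d2_load_lincomb_test real_polynomial_function_Pk)

lemma weak_d2_eq_riesz: "weak_d2 F k T i j v = Pk.riesz (k - 2) (d2_load F T i j v)"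
  unfolding weak_d2_def Pk.riesz_def d2_load_def by (simp add: split_beta ip_eq_vip)

lemma weak_d2_in_Pk: "v \<in> W_local F k T \<Longrightarrow> weak_d2 F k T i j v \<in> Pk (k - 2)"
  unfolding weak_d2_eq_riesz by (intro Pk.riesz_in linear_form_d2_load)

lemma weak_d2_lincomb:
  assumes "v \<in> W_local F k T" "w \<in> W_local F k T"
  shows "weak_d2 F k T i j (wg_lincomb c v w) = (\<lambda>x. c * weak_d2 F k T i j v x + weak_d2 F k T i j w x)"
  using Pk.riesz_lincomb[OF linear_form_d2_load[OF assms(1)] linear_form_d2_load[OF assms(2)]
      linear_form_d2_load[OF wg_lincomb_in_W_local[OF assms]] d2_load_wg_lincomb[OF assms real_polynomial_function_Pk]]
  unfolding weak_d2_eq_riesz by simp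

section \<open>Residuals and bilinearity of the local form\<close>

lemma residual_in:
  assumes "v \<in> W_local F k T" "e \<in> F T"
  shows bnd_residual_in_Pf: "bnd_residual k v e \<in> Pf (k - 2) e"
    and grad_residual_in_Pfv: "grad_residual k v e \<in> Pfv (k - 2) e"
proof -
  obtain v0 vb vg where v: "v = (v0, vb, vg)" by (metis prod.exhaust)
  note V = W_localD[OF assms(1)[unfolded v]]
  show "bnd_residual k v e \<in> Pf (k - 2) e"
    unfolding v bnd_residual_def prod.case
    by (intro lincomb_closed_diff[OF lincomb_closed_Pf] Qb_in_Pf flat_faces assms(2) V(3)
        continuous_on_real_polynomial_function V(2))
  show "grad_residual k v e \<in> Pfv (k - 2) e"
    unfolding v grad_residual_def prod.case
    by (intro lincomb_closed_diff[OF lincomb_closed_Pfv] Qbv_in_Pfv flat_faces assms(2) V(4)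
        continuous_on_grad_polynomial V(2))
qed

lemma residual_lincomb:
  assumes "v \<in> W_local F k T" "w \<in> W_local F k T" "e \<in> F T"
  shows bnd_residual_lincomb: "bnd_residual k (wg_lincomb c v w) e
      = (\<lambda>x. c * bnd_residual k v e x + bnd_residual k w e x)"
    and grad_residual_lincomb: "grad_residual k (wg_lincomb c v w) e
      = (\<lambda>x. c *\<^sub>R grad_residual k v e x + grad_residual k w e x)"
proof -
  obtain v0 vb vg w0 wb wg where vw: "v = (v0, vb, vg)" "w = (w0, wb, wg)" by (metis prod.exhaust)
  note V = W_localD(2)[OF assms(1)[unfolded vw]] and W = W_localD(2)[OF assms(2)[unfolded vw]]
  have "Qb k e (\<lambda>x. c * v0 x + w0 x) = (\<lambda>x. c * Qb k e v0 x + Qb k e w0 x)"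
    by (intro Qb_lincomb flat_faces assms(3) continuous_on_real_polynomial_function V W)
  then show "bnd_residual k (wg_lincomb c v w) e = (\<lambda>x. c * bnd_residual k v e x + bnd_residual k w e x)"
    unfolding vw bnd_residual_def wg_lincomb_def by (simp add: algebra_simps)
  have "Qbv k e (grad (\<lambda>x. c * v0 x + w0 x)) = (\<lambda>x. c *\<^sub>R Qbv k e (grad v0) x + Qbv k e (grad w0) x)"
    unfolding grad_lincomb_polynomial[OF V W]
    by (intro Qbv_lincomb flat_faces assms(3) continuous_on_grad_polynomial V W)
  then show "grad_residual k (wg_lincomb c v w) e = (\<lambda>x. c *\<^sub>R grad_residual k v e x + grad_residual k w e x)"
    unfolding vw grad_residual_def wg_lincomb_def by (simp add: algebra_simps)
qed

lemma as_form_lincomb_right: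
  assumes u: "u \<in> W_local F k T" and v: "v \<in> W_local F k T" and w: "w \<in> W_local F k T"
  shows "as_form F k T u (wg_lincomb c v w) = c * as_form F k T u v + as_form F k T u w"
proof -
  have a: "a_form F k T u (wg_lincomb c v w) = c * a_form F k T u v + a_form F k T u w"
    unfolding a_form_def weak_d2_lincomb[OF v w] ip_eq_vip
    using Pk.vip_lincomb_right_V[OF weak_d2_in_Pk[OF v] weak_d2_in_Pk[OF w] weak_d2_in_Pk[OF u]]
    by (intro sum_lincomb) simp
  have g: "(\<Sum>e\<in>F T. vip (surface e) (grad_residual k u e) (grad_residual k (wg_lincomb c v w) e))
    = c * (\<Sum>e\<in>F T. vip (surface e) (grad_residual k u e) (grad_residual k v e))
      + (\<Sum>e\<in>F T. vip (surface e) (grad_residual k u e) (grad_residual k w e))"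
  proof (rule sum_lincomb)
    fix e assume e: "e \<in> F T"
    show "vip (surface e) (grad_residual k u e) (grad_residual k (wg_lincomb c v w) e)
      = c * vip (surface e) (grad_residual k u e) (grad_residual k v e)
        + vip (surface e) (grad_residual k u e) (grad_residual k w e)"
      unfolding grad_residual_lincomb[OF v w e]
      by (intro l2_space.vip_lincomb_right_V[OF l2_space_Pfv[OF flat_faces[OF e], of "k - 2"]]
          grad_residual_in_Pfv[OF _ e] u v w)
  qed
  have b: "(\<Sum>e\<in>F T. ip (surface e) (bnd_residual k u e) (bnd_residual k (wg_lincomb c v w) e))
    = c * (\<Sum>e\<in>F T. ip (surface e) (bnd_residual k u e) (bnd_residual k v e))
      + (\<Sum>e\<in>F T. ip (surface e) (bnd_residual k u e) (bnd_residual k w e))"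
  proof (rule sum_lincomb)
    fix e assume e: "e \<in> F T"
    show "ip (surface e) (bnd_residual k u e) (bnd_residual k (wg_lincomb c v w) e)
      = c * ip (surface e) (bnd_residual k u e) (bnd_residual k v e)
        + ip (surface e) (bnd_residual k u e) (bnd_residual k w e)"
      using l2_space.vip_lincomb_right_V[OF l2_space_Pf[OF flat_faces[OF e]]
          bnd_residual_in_Pf[OF v e] bnd_residual_in_Pf[OF w e] bnd_residual_in_Pf[OF u e], of c]
      unfolding bnd_residual_lincomb[OF v w e] ip_eq_vip by simp
  qed
  show ?thesis unfolding as_form_def s_form_eq a g b by (simp add: algebra_simps)
qed

lemma as_form_commute: "as_form F k T u v = as_form F k T v u"
  unfolding as_form_def s_form_eq a_form_def by (simp add: ip_commute vip_commute)

lemma as_form_lincomb_left: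
  "u \<in> W_local F k T \<Longrightarrow> v \<in> W_local F k T \<Longrightarrow> w \<in> W_local F k T \<Longrightarrow>
    as_form F k T (wg_lincomb c v w) u = c * as_form F k T v u + as_form F k T w u"
  using as_form_lincomb_right as_form_commute by metis

section \<open>Semidefiniteness and independence of the local solution\<close>

lemma as_form_nonneg: "as_form F k T u u \<ge> 0"
  unfolding as_form_def s_form_eq a_form_def ip_eq_vip
  by (intro add_nonneg_nonneg mult_nonneg_nonneg sum_nonneg vip_nonneg)
    (simp_all add: diameter_ge_0 compact_imp_bounded compact_T)

text \<open>For a null vector \<open>u\<close> the quadratic form along \<open>t u + v\<close> is
  affine in \<open>t\<close>, and a nonconstant affine function takes negative values.\<close>

lemma as_form_null:
  assumes u: "u \<in> W_local F k T" and v: "v \<in> W_local F k T" and null: "as_form F k T u u = 0"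
  shows "as_form F k T u v = 0"
proof (rule ccontr)
  let ?a = "as_form F k T"
  assume nz: "?a u v \<noteq> 0"
  \<comment> \<open>Chosen so that the form takes the value -1 at \<open>t u + v\<close>.\<close>
  define t where "t = - (?a v v + 1) / (2 * ?a u v)"
  let ?w = "wg_lincomb t u v"
  have w: "?w \<in> W_local F k T" by (rule wg_lincomb_in_W_local[OF u v])
  have "?a ?w ?w = 2 * t * ?a u v + ?a v v"
    by (simp add: as_form_lincomb_right[OF w u v] as_form_lincomb_left[OF u u v]
        as_form_lincomb_left[OF v u v] null as_form_commute[of v u])
  also have "\<dots> = -1" using nz by (simp add: t_def field_simps)
  finally show False using as_form_nonneg[of ?w] by simp
qed

text \<open>Face families are total functions on sets; this allows them to be cut off outside the
  faces of \<open>T\<close>.\<close>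

lemma as_form_cong:
  assumes "\<And>e. e \<in> F T \<Longrightarrow> vb e = vb' e" "\<And>e. e \<in> F T \<Longrightarrow> vg e = vg' e"
  shows "as_form F k T u (v0, vb, vg) = as_form F k T u (v0, vb', vg')"
proof -
  have "d2_load F T i j (v0, vb, vg) = d2_load F T i j (v0, vb', vg')" for i j
    unfolding d2_load_def prod.case using assms by (simp cong: sum.cong)
  then show ?thesis
    unfolding as_form_def a_form_def weak_d2_eq_riesz s_form_eq
    using assms by (simp add: bnd_residual_def grad_residual_def cong: sum.cong)
qed

text \<open>The difference of two local solutions lies in the kernel of the semidefinite form, so their
  uniqueness is not needed.\<close>

lemma as_form_local_solution_unique:
  assumes bg: "(b, g) \<in> face_space k (F T)"
    and u: "local_solution F k f T (u0, b, g)" and w: "local_solution F k f T (w0, b, g)"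
    and v: "v \<in> W_local F k T"
  shows "as_form F k T (u0, b, g) v = as_form F k T (w0, b, g) v"
proof -
  let ?u = "(u0, b, g)" and ?w = "(w0, b, g)"
  have uW: "?u \<in> W_local F k T" and wW: "?w \<in> W_local F k T"
    using bg u w unfolding W_local_def local_solution_def by auto
  define d where "d = wg_lincomb (-1) ?u ?w"
  have dW: "d \<in> W_local F k T" unfolding d_def by (rule wg_lincomb_in_W_local[OF uW wW])
  have as_d: "as_form F k T d v' = as_form F k T ?w v' - as_form F k T ?u v'"
    if "v' \<in> W_local F k T" for v'
    unfolding d_def using as_form_lincomb_left[OF that uW wW, of "-1"] by simp
  \<comment> \<open>Both solutions carry the same boundary values, so those of \<open>d\<close>
    cancel and \<open>d\<close> is itself a test function of the local problem.\<close>
  obtain d0 where d0: "d = (d0, \<lambda>_ _. 0, \<lambda>_ _. 0)" unfolding d_def wg_lincomb_def by simp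
  have "d0 \<in> Pk k" using dW unfolding d0 W_local_def by simp
  then have "as_form F k T ?w d = as_form F k T ?u d"
    using u w unfolding d0 local_solution_def by simp
  then have "as_form F k T d d = 0" using as_d[OF dW] by simp
  then have "as_form F k T d v = 0" by (rule as_form_null[OF dW v])
  then show ?thesis using as_d[OF v] by simp
qed

text \<open>The given solution shows that the choice in \<open>Df\<close> is not vacuous; the chosen
  interior part may be another one, but it yields the same functional.\<close>

lemma as_form_Df:
  assumes "(b, g) \<in> face_space k (F T)" "local_solution F k f T (u0, b, g)" "v \<in> W_local F k T"
  shows "as_form F k T (Df F k f T (b, g), b, g) v = as_form F k T (u0, b, g) v"
    and "local_solution F k f T (Df F k f T (b, g), b, g)"
proof -
  show Df: "local_solution F k f T (Df F k f T (b, g), b, g)"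
    unfolding Df_def prod.case using someI[of "\<lambda>w0. local_solution F k f T (w0, b, g)", OF assms(2)] .
  show "as_form F k T (Df F k f T (b, g), b, g) v = as_form F k T (u0, b, g) v"
    by (rule as_form_local_solution_unique[OF assms(1) Df assms(2,3)])
qed

section \<open>Existence and defining property of \<zeta>\<close>

definition single :: "(real^'n) set \<Rightarrow> (real^'n \<Rightarrow> 'b::zero) \<Rightarrow> (real^'n) set \<Rightarrow> real^'n \<Rightarrow> 'b" where
  "single e \<phi> = (\<lambda>_ _. 0)(e := \<phi>)"

lemma single_in_W_local:
  shows "\<phi> \<in> Pf (k - 2) e \<Longrightarrow> (\<lambda>_. 0, single e \<phi>, \<lambda>_ _. 0) \<in> W_local F k T"
    and "\<psi> \<in> Pfv (k - 2) e \<Longrightarrow> (\<lambda>_. 0, \<lambda>_ _. 0, single e \<psi>) \<in> W_local F k T"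
  unfolding W_local_def face_space_def single_def
  by (auto intro: lincomb_closed_zero lincomb_closed_Pk lincomb_closed_Pf lincomb_closed_Pfv)

text \<open>\<open>b_form\<close> decouples over faces and over the scalar and vector components.
  Each restricted functional is represented separately, and the representatives are collected into
  one family.\<close>

lemma interface_functional_representable:
  assumes u: "u \<in> W_local F k T"
  shows "\<exists>\<zeta>. \<zeta> \<in> Lambda_local F k T \<and> (\<forall>(vb, vg)\<in>face_space k (F T).
    b_form F T (\<lambda>_. 0, vb, vg) \<zeta> = as_form F k T u (\<lambda>_. 0, vb, vg))"
proof -
  define lb where "lb = (\<lambda>e \<phi>. as_form F k T u (\<lambda>_. 0, single e \<phi>, \<lambda>_ _. 0))"
  define lg where "lg = (\<lambda>e \<psi>. as_form F k T u (\<lambda>_. 0, \<lambda>_ _. 0, single e \<psi>))"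
  have lb: "linear_form (Pf (k - 2) e) (lb e)" for e
    unfolding linear_form_def
  proof (intro ballI allI)
    fix \<phi> \<psi> :: "real^'n \<Rightarrow> real" and c :: real assume "\<phi> \<in> Pf (k - 2) e" "\<psi> \<in> Pf (k - 2) e"
    note single_in_W_local(1)[OF this(1)] single_in_W_local(1)[OF this(2)]
    note as_form_lincomb_right[OF u this, of c]
    moreover have "wg_lincomb c (\<lambda>_. 0, single e \<phi>, \<lambda>_ _. 0) (\<lambda>_. 0, single e \<psi>, \<lambda>_ _. 0)
      = (\<lambda>_. 0, single e (\<lambda>x. c *\<^sub>R \<phi> x + \<psi> x), \<lambda>_ _. 0)"
      unfolding wg_lincomb_def single_def by (auto simp: fun_eq_iff)
    ultimately
    show "lb e (\<lambda>x. c *\<^sub>R \<phi> x + \<psi> x) = c * lb e \<phi> + lb e \<psi>"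
      unfolding lb_def by simp
  qed
  have lg: "linear_form (Pfv (k - 2) e) (lg e)" for e
    unfolding linear_form_def
  proof (intro ballI allI)
    fix \<phi> \<psi> :: "real^'n \<Rightarrow> real^'n" and c :: real assume "\<phi> \<in> Pfv (k - 2) e" "\<psi> \<in> Pfv (k - 2) e"
    note single_in_W_local(2)[OF this(1)] single_in_W_local(2)[OF this(2)]
    note as_form_lincomb_right[OF u this, of c]
    moreover have "wg_lincomb c (\<lambda>_. 0, \<lambda>_ _. 0, single e \<phi>) (\<lambda>_. 0, \<lambda>_ _. 0, single e \<psi>)
      = (\<lambda>_. 0, \<lambda>_ _. 0, single e (\<lambda>x. c *\<^sub>R \<phi> x + \<psi> x))"
      unfolding wg_lincomb_def single_def by (auto simp: fun_eq_iff)
    ultimately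
    show "lg e (\<lambda>x. c *\<^sub>R \<phi> x + \<psi> x) = c * lg e \<phi> + lg e \<psi>"
      unfolding lg_def by simp
  qed
  define zb where "zb = (\<lambda>e. l2_space.riesz (surface e) (Pf (k - 2) e) (lb e))"
  define zg where "zg = (\<lambda>e. l2_space.riesz (surface e) (Pfv (k - 2) e) (lg e))"
  have zb: "zb e \<in> Pf (k - 2) e" "\<And>\<phi>. \<phi> \<in> Pf (k - 2) e \<Longrightarrow> vip (surface e) (zb e) \<phi> = lb e \<phi>"
    and zg: "zg e \<in> Pfv (k - 2) e" "\<And>\<phi>. \<phi> \<in> Pfv (k - 2) e \<Longrightarrow> vip (surface e) (zg e) \<phi> = lg e \<phi>"
    if "e \<in> F T" for e
    unfolding zb_def zg_def
    using l2_space.riesz[OF l2_space_Pf[OF flat_faces[OF that]] lb]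
      l2_space.riesz[OF l2_space_Pfv[OF flat_faces[OF that]] lg] by auto
  have "b_form F T (\<lambda>_. 0, vb, vg) (zb, zg) = as_form F k T u (\<lambda>_. 0, vb, vg)"
    if v: "(vb, vg) \<in> face_space k (F T)" for vb vg
  proof -
    have vbg: "vb e \<in> Pf (k - 2) e" "vg e \<in> Pfv (k - 2) e" if "e \<in> F T" for e
      using v that unfolding face_space_def by auto
    \<comment> \<open>Boundary data kept on the faces in \<open>E\<close> only; induction on
      \<open>E\<close> splits the functional into its contributions from single faces.\<close>
    define cut where "cut E = (\<lambda>_::real^'n. 0::real, \<lambda>e x. if e \<in> E then vb e x else 0, \<lambda>e x. if e \<in> E then vg e x else 0)" for E
    have cut: "cut E \<in> W_local F k T \<and>
        as_form F k T u (cut E) = (\<Sum>e\<in>E. ip (surface e) (vb e) (zb e) + vip (surface e) (vg e) (zg e))"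
      if "finite E" "E \<subseteq> F T" for E
      using that
    proof (induction E rule: finite_induct)
      case empty
      have z: "cut {} \<in> W_local F k T"
        unfolding W_local_def cut_def
        by (auto intro: lincomb_closed_zero lincomb_closed_Pk face_space_zero)
      \<comment> \<open>Writing the zero function as minus itself plus itself turns linearity into
        the value 0.\<close>
      have "wg_lincomb (-1) (cut {}) (cut {}) = cut {}" unfolding wg_lincomb_def cut_def by simp
      then have "as_form F k T u (cut {}) = 0" using as_form_lincomb_right[OF u z z, of "-1"] by simp
      then show ?case using z by simp
    next
      case (insert e E)
      let ?b = "(\<lambda>_. 0, single e (vb e), \<lambda>_ _. 0)" and ?g = "(\<lambda>_. 0, \<lambda>_ _. 0, single e (vg e))"
      have e: "e \<in> F T" and IH: "cut E \<in> W_local F k T"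
        "as_form F k T u (cut E) = (\<Sum>e\<in>E. ip (surface e) (vb e) (zb e) + vip (surface e) (vg e) (zg e))"
        using insert by auto
      have b: "?b \<in> W_local F k T" and g: "?g \<in> W_local F k T"
        by (intro single_in_W_local vbg e)+
      have gE: "wg_lincomb 1 ?g (cut E) \<in> W_local F k T" by (rule wg_lincomb_in_W_local[OF g IH(1)])
      \<comment> \<open>Since \<open>e\<close> is not in \<open>E\<close>, the old truncation is
        zero at \<open>e\<close>, so the two new pieces are counted once.\<close>
      have "cut (insert e E) = wg_lincomb 1 ?b (wg_lincomb 1 ?g (cut E))"
        using insert.hyps(2) unfolding cut_def wg_lincomb_def single_def by (auto simp: fun_eq_iff)
      moreover have "as_form F k T u ?b = ip (surface e) (vb e) (zb e)"
        using zb(2)[OF e vbg(1)[OF e]] unfolding lb_def ip_eq_vip vip_commute[of _ "vb e"] by simp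
      moreover have "as_form F k T u ?g = vip (surface e) (vg e) (zg e)"
        using zg(2)[OF e vbg(2)[OF e]] unfolding lg_def vip_commute[of _ "vg e"] by simp
      ultimately show ?case
        using wg_lincomb_in_W_local[OF b gE, of 1] as_form_lincomb_right[OF u b gE, of 1]
          as_form_lincomb_right[OF u g IH(1), of 1] IH(2) insert.hyps by simp
    qed
    have "as_form F k T u (\<lambda>_. 0, vb, vg) = as_form F k T u (cut (F T))"
      unfolding cut_def by (rule as_form_cong) auto
    then show ?thesis
      using cut[OF finite_faces subset_refl] unfolding b_form_def by (simp add: sum.distrib)
  qed
  then show ?thesis
    using zb(1) zg(1) unfolding Lambda_local_def face_space_def by (intro exI[of _ "(zb, zg)"]) auto
qed

text \<open>\<open>Lf\<close> is defined through the interior part chosen by \<open>Df\<close>; here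
  it is tied to an arbitrary local solution with the same boundary data.\<close>

lemma Lf:
  assumes bg: "(b, g) \<in> face_space k (F T)" and u: "local_solution F k f T (u0, b, g)"
  shows Lf_in: "Lf F k f T (b, g) \<in> face_space k (F T)"
    and b_form_Lf: "(vb, vg) \<in> face_space k (F T) \<Longrightarrow>
      b_form F T (\<lambda>_. 0, vb, vg) (Lf F k f T (b, g)) = as_form F k T (u0, b, g) (\<lambda>_. 0, vb, vg)"
proof -
  have zero: "(\<lambda>_. 0) \<in> Pk k" by (rule lincomb_closed_zero[OF lincomb_closed_Pk])
  have v: "(\<lambda>_. 0, vb, vg) \<in> W_local F k T" if "(vb, vg) \<in> face_space k (F T)" for vb vg
    using that zero unfolding W_local_def by simp
  have "local_solution F k f T (Df F k f T (b, g), b, g)"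
    by (rule as_form_Df(2)[OF bg u v[OF bg]])
  then have "(Df F k f T (b, g), b, g) \<in> W_local F k T"
    using bg unfolding local_solution_def W_local_def by simp
  from someI_ex[OF interface_functional_representable[OF this]]
  have "Lf F k f T (b, g) \<in> Lambda_local F k T \<and> (\<forall>(vb, vg)\<in>face_space k (F T).
    b_form F T (\<lambda>_. 0, vb, vg) (Lf F k f T (b, g)) = as_form F k T (Df F k f T (b, g), b, g) (\<lambda>_. 0, vb, vg))"
    unfolding Lf_def fst_conv snd_conv .
  then show "Lf F k f T (b, g) \<in> face_space k (F T)"
    and "(vb, vg) \<in> face_space k (F T) \<Longrightarrow>
      b_form F T (\<lambda>_. 0, vb, vg) (Lf F k f T (b, g)) = as_form F k T (u0, b, g) (\<lambda>_. 0, vb, vg)"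
    using as_form_Df(1)[OF bg u v] unfolding Lambda_local_def by auto
qed

lemma as_form_local_solution_split:
  assumes bg: "(b, g) \<in> face_space k (F T)" and u: "local_solution F k f T (u0, b, g)"
    and v: "v \<in> W_local F k T"
  shows "as_form F k T (u0, b, g) v
    = ip (lebesgue_on T) f (fst v) + b_form F T v (Lf F k f T (b, g))"
proof -
  obtain v0 vb vg where vv: "v = (v0, vb, vg)" by (metis prod.exhaust)
  have v0: "v0 \<in> Pk k" and vbg: "(vb, vg) \<in> face_space k (F T)"
    using v unfolding vv W_local_def by auto
  have uW: "(u0, b, g) \<in> W_local F k T" using bg u unfolding W_local_def local_solution_def by auto
  have zero: "(\<lambda>_. 0) \<in> Pk k" by (rule lincomb_closed_zero[OF lincomb_closed_Pk])
  have i: "(v0, \<lambda>_ _. 0, \<lambda>_ _. 0) \<in> W_local F k T" and b: "(\<lambda>_. 0, vb, vg) \<in> W_local F k T"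
    using v0 zero vbg face_space_zero unfolding W_local_def by auto
  have "v = wg_lincomb 1 (v0, \<lambda>_ _. 0, \<lambda>_ _. 0) (\<lambda>_. 0, vb, vg)"
    unfolding vv wg_lincomb_def by simp
  then have "as_form F k T (u0, b, g) v
    = as_form F k T (u0, b, g) (v0, \<lambda>_ _. 0, \<lambda>_ _. 0) + as_form F k T (u0, b, g) (\<lambda>_. 0, vb, vg)"
    using as_form_lincomb_right[OF uW i b, of 1] by simp
  also have "as_form F k T (u0, b, g) (v0, \<lambda>_ _. 0, \<lambda>_ _. 0) = ip (lebesgue_on T) f v0"
    using u v0 unfolding local_solution_def by simp
  \<comment> \<open>\<open>b_form\<close> reads the boundary components alone, so the full
    \<open>v\<close> may stand in for its boundary part.\<close>
  also have "as_form F k T (u0, b, g) (\<lambda>_. 0, vb, vg) = b_form F T v (Lf F k f T (b, g))"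
    unfolding b_form_Lf[OF bg u vbg, symmetric] vv b_form_def by (simp add: split_beta)
  finally show ?thesis by (simp add: vv)
qed

end

section \<open>Assembly over the mesh\<close>

lemma (in flat_face) negligible_face: "negligible e"
proof -
  obtain n a where n: "is_unit_normal e n" and "a \<in> e"
    using normal_ex face_nonempty by blast
  have "e \<subseteq> {x. n \<bullet> x = n \<bullet> a}"
  proof
    fix x assume "x \<in> e"
    then have "(x - a) \<bullet> n = 0" using n \<open>a \<in> e\<close> unfolding is_unit_normal_def by blast
    then show "x \<in> {x. n \<bullet> x = n \<bullet> a}" by (simp add: inner_diff_left inner_commute[of n])
  qed
  moreover have "n \<noteq> 0" using n unfolding is_unit_normal_def by auto
  ultimately show ?thesis using negligible_hyperplane negligible_subset by blast
qed

lemma (in wg_element) negligible_frontier: "negligible (frontier T)"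
  using element finite_faces flat_face.negligible_face[OF flat_faces]
  unfolding polytopal_element_def by (auto intro: negligible_Union)

section \<open>The global load as a sum of element loads\<close>

lemma L2_mult_integrable:
  fixes p :: "'a::euclidean_space \<Rightarrow> real"
  assumes \<Omega>: "bounded \<Omega>" "\<Omega> \<in> sets lebesgue" and f: "L2 (lebesgue_on \<Omega>) f" and p: "continuous_on UNIV p"
  shows "integrable (lebesgue_on \<Omega>) (\<lambda>x. f x * p x)"
proof -
  interpret finite_measure "lebesgue_on \<Omega>"
    by (intro finite_measure_lebesgue_on bounded_set_imp_lmeasurable \<Omega>)
  have "bounded (p ` closure \<Omega>)"
    using \<Omega>(1) p by (intro compact_imp_bounded compact_continuous_image)
      (auto intro: continuous_on_subset)
  then obtain B where B: "\<And>x. x \<in> closure \<Omega> \<Longrightarrow> norm (p x) \<le> B" unfolding bounded_iff by blast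
  have [measurable]: "f \<in> borel_measurable (lebesgue_on \<Omega>)" using f unfolding L2_def by blast
  have [measurable]: "p \<in> borel_measurable (lebesgue_on \<Omega>)"
    using \<Omega>(2) p by (intro continuous_imp_measurable_on_sets_lebesgue) (auto intro: continuous_on_subset)
  show ?thesis
  proof (rule Bochner_Integration.integrable_bound)
    show "integrable (lebesgue_on \<Omega>) (\<lambda>x. B * (1 + (f x)\<^sup>2))"
      using f unfolding L2_def by (intro integrable_mult_right Bochner_Integration.integrable_add) auto
    have "norm (f x * p x) \<le> norm (B * (1 + (f x)\<^sup>2))" if "x \<in> \<Omega>" for x
    proof -
      have pB: "\<bar>p x\<bar> \<le> B" using B[of x] that closure_subset by auto
      \<comment> \<open>On a set of finite measure, 1 plus the square of \<open>f\<close> is an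
        integrable majorant of \<open>f\<close>; the factor \<open>p\<close> is bounded by
        \<open>B\<close> on the compact closure.\<close>
      have "\<bar>f x\<bar> \<le> 1 + (f x)\<^sup>2"
        using zero_le_power2[of "\<bar>f x\<bar> - 1"] by (simp add: power2_diff algebra_simps)
      then have "\<bar>f x\<bar> * \<bar>p x\<bar> \<le> (1 + (f x)\<^sup>2) * B"
        using pB by (intro mult_mono) auto
      also have "\<dots> \<le> \<bar>B * (1 + (f x)\<^sup>2)\<bar>" by (simp add: mult.commute)
      finally show ?thesis by (simp add: abs_mult)
    qed
    then show "AE x in lebesgue_on \<Omega>. norm (f x * p x) \<le> norm (B * (1 + (f x)\<^sup>2))"
      by (intro AE_I2) simp
  qed measurable
qed

text \<open>The load is assembled on \<Omega> from open interiors, whereas local problems integrate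
  over closed elements; the two differ by the null frontier.\<close>

lemma ip_interior_eq:
  fixes f g :: "'a::euclidean_space \<Rightarrow> real"
  assumes \<Omega>: "\<Omega> \<in> sets lebesgue" "interior T \<subseteq> \<Omega>" and T: "compact T" "negligible (frontier T)"
    and fg: "integrable (lebesgue_on \<Omega>) (\<lambda>x. f x * g x)"
  shows "integrable (lebesgue_on \<Omega>) (\<lambda>x. f x * (indicator (interior T) x * g x))"
    and "ip (lebesgue_on \<Omega>) f (\<lambda>x. indicator (interior T) x * g x) = ip (lebesgue_on T) f g"
proof -
  let ?h = "\<lambda>x. indicator (interior T) x * (f x * g x)"
  have eq: "indicator \<Omega> x *\<^sub>R (f x * (indicator (interior T) x * g x)) = ?h x" for x
    using \<Omega>(2) by (auto simp: indicator_def)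
  have Tm: "T \<in> sets lebesgue" using lmeasurable_compact[OF T(1)] by auto
  have "integrable lebesgue (\<lambda>x. indicator \<Omega> x *\<^sub>R (f x * g x))"
    using fg \<Omega>(1) by (simp add: integrable_restrict_space)
  moreover have "interior T \<in> sets lebesgue" by (simp add: borel_open)
  ultimately have "integrable lebesgue (\<lambda>x. indicator (interior T) x *\<^sub>R (indicator \<Omega> x *\<^sub>R (f x * g x)))"
    by (rule integrable_mult_indicator[rotated])
  moreover have "(\<lambda>x. indicator (interior T) x *\<^sub>R (indicator \<Omega> x *\<^sub>R (f x * g x))) = ?h"
    using \<Omega>(2) by (auto simp: indicator_def fun_eq_iff)
  ultimately have h: "integrable lebesgue ?h" by (rule back_subst)
  then show "integrable (lebesgue_on \<Omega>) (\<lambda>x. f x * (indicator (interior T) x * g x))"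
    using \<Omega>(1) by (simp add: integrable_restrict_space eq del: real_scaleR_def)
  have "AE x in lebesgue. x \<notin> frontier T"
    using T(2) unfolding negligible_iff_null_sets by (rule AE_not_in)
  then have AE: "AE x in lebesgue. ?h x = indicator T x *\<^sub>R (f x * g x)"
  proof eventually_elim
    case (elim x)
    then show ?case
      using interior_subset[of T] compact_imp_closed[OF T(1)]
      by (auto simp: indicator_def frontier_def)
  qed
  have "ip (lebesgue_on \<Omega>) f (\<lambda>x. indicator (interior T) x * g x) = integral\<^sup>L lebesgue ?h"
    unfolding ip_def using \<Omega>(1) by (simp add: integral_restrict_space eq del: real_scaleR_def)
  also have "\<dots> = integral\<^sup>L lebesgue (\<lambda>x. indicator T x *\<^sub>R (f x * g x))"
    using h AE borel_measurable_AE[OF _ AE] by (intro integral_cong_AE) auto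
  also have "\<dots> = ip (lebesgue_on T) f g"
    unfolding ip_def using Tm by (simp add: integral_restrict_space)
  finally show "ip (lebesgue_on \<Omega>) f (\<lambda>x. indicator (interior T) x * g x) = ip (lebesgue_on T) f g" .
qed

lemma ip_sum_right:
  assumes "\<And>i. i \<in> I \<Longrightarrow> integrable M (\<lambda>x. u x * v i x)"
  shows "ip M u (\<lambda>x. \<Sum>i\<in>I. v i x) = (\<Sum>i\<in>I. ip M u (v i))"
  unfolding ip_def sum_distrib_left using assms by (rule Bochner_Integration.integral_sum)

lemma vip_sum_right:
  assumes "\<And>i. i \<in> I \<Longrightarrow> integrable M (\<lambda>x. u x \<bullet> v i x)"
  shows "vip M u (\<lambda>x. \<Sum>i\<in>I. v i x) = (\<Sum>i\<in>I. vip M u (v i))"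
  unfolding vip_def inner_sum_right using assms by (rule Bochner_Integration.integral_sum)

locale wg_mesh =
  fixes \<Omega> :: "(real^'n) set" and Th :: "(real^'n) set set"
    and F :: "(real^'n) set \<Rightarrow> (real^'n) set set" and k :: nat
  assumes mesh: "polytopal_mesh \<Omega> Th F"
begin

abbreviation "elements_at e \<equiv> {T \<in> Th. e \<in> F T}"

lemma finite_Th: "finite Th"
  using mesh by (simp add: polytopal_mesh_def)

lemma element: "T \<in> Th \<Longrightarrow> wg_element T F"
  using mesh by (simp add: polytopal_mesh_def wg_element_def)

lemma interior_subset_domain: "T \<in> Th \<Longrightarrow> interior T \<subseteq> \<Omega>"
  using mesh by (simp add: polytopal_mesh_def)

lemma finite_all_faces: "finite (all_faces Th F)"
  unfolding all_faces_def using finite_Th wg_element.finite_faces[OF element] by blast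

lemma flat_faces: "e \<in> all_faces Th F \<Longrightarrow> flat_face e"
  unfolding all_faces_def using wg_element.flat_faces[OF element] by blast

lemma load_eq_sum:
  assumes \<Omega>: "open \<Omega>" "bounded \<Omega>" and f: "L2 (lebesgue_on \<Omega>) f"
    and v: "\<And>T. T \<in> Th \<Longrightarrow> real_polynomial_function (fst (v T))"
  shows "load \<Omega> Th f v = (\<Sum>T\<in>Th. ip (lebesgue_on T) f (fst (v T)))"
proof -
  have \<Omega>m: "\<Omega> \<in> sets lebesgue" using \<Omega>(1) by (simp add: borel_open)
  note int = ip_interior_eq[OF \<Omega>m interior_subset_domain wg_element.compact_T[OF element]
      wg_element.negligible_frontier[OF element]
      L2_mult_integrable[OF \<Omega>(2) \<Omega>m f continuous_on_real_polynomial_function[OF v]]]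
  have "load \<Omega> Th f v
    = (\<Sum>T\<in>Th. ip (lebesgue_on \<Omega>) f (\<lambda>x. indicator (interior T) x * fst (v T) x))"
    unfolding load_def using int(1) by (intro ip_sum_right) blast
  also have "\<dots> = (\<Sum>T\<in>Th. ip (lebesgue_on T) f (fst (v T)))"
    using int(2) by (intro sum.cong) auto
  finally show ?thesis .
qed

lemma Vh0_in_W_local: "v \<in> Vh0 \<Omega> Th F k \<Longrightarrow> T \<in> Th \<Longrightarrow> v T \<in> W_local F k T"
  unfolding Vh0_def Vh_def Wh_def by simp

lemma Vh0_face_components:
  assumes "v \<in> Vh0 \<Omega> Th F k" "T \<in> Th" "e \<in> F T"
  shows "fst (snd (v T)) e \<in> Pf (k - 2) e" "snd (snd (v T)) e \<in> Pfv (k - 2) e"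
  using Vh0_in_W_local[OF assms(1,2)] assms(3) unfolding W_local_def face_space_def by fastforce+

text \<open>Boundary faces drop out because \<open>v\<close> vanishes there. On an interior face the
  common value of \<open>v\<close> leaves the sum over the adjacent elements, and the sum of the
  local \<zeta> remains.\<close>

lemma sum_b_form:
  assumes \<zeta>: "\<And>T. T \<in> Th \<Longrightarrow> \<zeta> T \<in> face_space k (F T)"
    and v: "v \<in> Vh0 \<Omega> Th F k"
    and \<mu>: "\<And>T e. T \<in> Th \<Longrightarrow> e \<in> F T \<Longrightarrow> e \<in> interior_faces \<Omega> Th F \<Longrightarrow>
      fst (snd (v T)) e = \<mu>b e \<and> snd (snd (v T)) e = \<mu>g e"
  shows "(\<Sum>T\<in>Th. b_form F T (v T) (\<zeta> T)) = (\<Sum>e\<in>interior_faces \<Omega> Th F.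
    ip (surface e) (\<mu>b e) (\<lambda>x. \<Sum>T\<in>elements_at e. fst (\<zeta> T) e x)
    + vip (surface e) (\<mu>g e) (\<lambda>x. \<Sum>T\<in>elements_at e. snd (\<zeta> T) e x))"
proof -
  define c where "c = (\<lambda>T e. ip (surface e) (fst (snd (v T)) e) (fst (\<zeta> T) e)
    + vip (surface e) (snd (snd (v T)) e) (snd (\<zeta> T) e))"
  have "(\<Sum>T\<in>Th. b_form F T (v T) (\<zeta> T)) = (\<Sum>T\<in>Th. \<Sum>e\<in>{e\<in>all_faces Th F. e \<in> F T}. c T e)"
  proof (rule sum.cong[OF refl])
    fix T assume "T \<in> Th"
    then have "{e\<in>all_faces Th F. e \<in> F T} = F T" unfolding all_faces_def by blast
    then show "b_form F T (v T) (\<zeta> T) = (\<Sum>e\<in>{e\<in>all_faces Th F. e \<in> F T}. c T e)"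
      unfolding b_form_def c_def by (simp add: split_beta sum.distrib)
  qed
  also have "\<dots> = (\<Sum>e\<in>all_faces Th F. \<Sum>T\<in>elements_at e. c T e)"
    by (rule sum.swap_restrict[OF finite_Th finite_all_faces])
  also have "\<dots> = (\<Sum>e\<in>interior_faces \<Omega> Th F. \<Sum>T\<in>elements_at e. c T e)"
  proof (rule sum.mono_neutral_right[OF finite_all_faces])
    show "interior_faces \<Omega> Th F \<subseteq> all_faces Th F" unfolding interior_faces_def by blast
    have "c T e = 0" if "T \<in> Th" "e \<in> F T" "e \<in> all_faces Th F - interior_faces \<Omega> Th F" for T e
    proof -
      have "e \<subseteq> frontier \<Omega>" using that unfolding interior_faces_def by blast
      then have "fst (snd (v T)) e = (\<lambda>_. 0)" "snd (snd (v T)) e = (\<lambda>_. 0)"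
        using v that unfolding Vh0_def by auto
      then show ?thesis unfolding c_def ip_def vip_def by simp
    qed
    then show "\<forall>e\<in>all_faces Th F - interior_faces \<Omega> Th F. (\<Sum>T\<in>elements_at e. c T e) = 0" by simp
  qed
  also have "\<dots> = (\<Sum>e\<in>interior_faces \<Omega> Th F.
    ip (surface e) (\<mu>b e) (\<lambda>x. \<Sum>T\<in>elements_at e. fst (\<zeta> T) e x)
    + vip (surface e) (\<mu>g e) (\<lambda>x. \<Sum>T\<in>elements_at e. snd (\<zeta> T) e x))"
  proof (rule sum.cong[OF refl])
    fix e assume e: "e \<in> interior_faces \<Omega> Th F"
    then have face: "flat_face e" using flat_faces unfolding interior_faces_def by blast
    have zin: "fst (\<zeta> T) e \<in> Pf (k - 2) e" "snd (\<zeta> T) e \<in> Pfv (k - 2) e" if "T \<in> elements_at e" for T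
      using \<zeta>[of T] that unfolding face_space_def by auto
    have vin: "\<mu>b e \<in> Pf (k - 2) e" "\<mu>g e \<in> Pfv (k - 2) e" if "T \<in> elements_at e" for T
      using Vh0_face_components[OF v, of T e] \<mu>[of T e] e that by auto
    have "(\<Sum>T\<in>elements_at e. c T e) = (\<Sum>T\<in>elements_at e. ip (surface e) (\<mu>b e) (fst (\<zeta> T) e))
        + (\<Sum>T\<in>elements_at e. vip (surface e) (\<mu>g e) (snd (\<zeta> T) e))"
      unfolding c_def sum.distrib using \<mu> e by simp
    also have "(\<Sum>T\<in>elements_at e. ip (surface e) (\<mu>b e) (fst (\<zeta> T) e))
        = ip (surface e) (\<mu>b e) (\<lambda>x. \<Sum>T\<in>elements_at e. fst (\<zeta> T) e x)"
      using l2_space.integrable_inner[OF l2_space_Pf[OF face] vin(1) zin(1)]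
      by (intro ip_sum_right[symmetric]) simp
    also have "(\<Sum>T\<in>elements_at e. vip (surface e) (\<mu>g e) (snd (\<zeta> T) e))
        = vip (surface e) (\<mu>g e) (\<lambda>x. \<Sum>T\<in>elements_at e. snd (\<zeta> T) e x)"
      using l2_space.integrable_inner[OF l2_space_Pfv[OF face] vin(2) zin(2)]
      by (intro vip_sum_right[symmetric]) simp
    finally show "(\<Sum>T\<in>elements_at e. c T e)
      = ip (surface e) (\<mu>b e) (\<lambda>x. \<Sum>T\<in>elements_at e. fst (\<zeta> T) e x)
        + vip (surface e) (\<mu>g e) (\<lambda>x. \<Sum>T\<in>elements_at e. snd (\<zeta> T) e x)" .
  qed
  finally show ?thesis .
qed

lemma Vh0_single_valued:
  assumes "v \<in> Vh0 \<Omega> Th F k" "e \<in> interior_faces \<Omega> Th F" "S \<in> Th" "e \<in> F S" "T \<in> Th" "e \<in> F T"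
  shows "fst (snd (v T)) e = fst (snd (v S)) e \<and> snd (snd (v T)) e = snd (snd (v S)) e"
proof -
  have "\<forall>e\<in>interior_faces \<Omega> Th F. \<forall>T1\<in>Th. \<forall>T2\<in>Th. e \<in> F T1 \<and> e \<in> F T2 \<longrightarrow>
       fst (snd (v T1)) e = fst (snd (v T2)) e \<and> snd (snd (v T1)) e = snd (snd (v T2)) e"
    using assms(1) unfolding Vh0_def Vh_def mem_Collect_eq by (elim conjE)
  then show ?thesis using assms(2-6) by blast
qed

text \<open>For the direction from left to right, test with the interface sums themselves.\<close>

lemma sum_b_form_eq_0_iff:
  assumes \<zeta>: "\<And>T. T \<in> Th \<Longrightarrow> \<zeta> T \<in> face_space k (F T)"
  shows "(\<forall>v\<in>Vh0 \<Omega> Th F k. (\<Sum>T\<in>Th. b_form F T (v T) (\<zeta> T)) = 0)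
    \<longleftrightarrow> (\<forall>e\<in>interior_faces \<Omega> Th F. (\<lambda>x. \<Sum>T\<in>elements_at e. fst (\<zeta> T) e x) = (\<lambda>_. 0) \<and>
          (\<lambda>x. \<Sum>T\<in>elements_at e. snd (\<zeta> T) e x) = (\<lambda>_. 0))"
    (is "?L \<longleftrightarrow> ?R")
proof
  assume R: ?R
  show ?L
  proof
    fix v assume v: "v \<in> Vh0 \<Omega> Th F k"
    \<comment> \<open>An arbitrary adjacent element supplies the value on \<open>e\<close>;
      single-valuedness makes it valid for every other one.\<close>
    define S where "S e = (SOME T. T \<in> elements_at e)" for e
    define \<mu>b where "\<mu>b e = fst (snd (v (S e))) e" for e
    define \<mu>g where "\<mu>g e = snd (snd (v (S e))) e" for e
    have \<mu>: "fst (snd (v T)) e = \<mu>b e \<and> snd (snd (v T)) e = \<mu>g e"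
      if "T \<in> Th" "e \<in> F T" "e \<in> interior_faces \<Omega> Th F" for T e
    proof -
      have "S e \<in> elements_at e" unfolding S_def by (rule someI[of _ T]) (use that in simp)
      then show ?thesis
        unfolding \<mu>b_def \<mu>g_def using Vh0_single_valued[OF v, of e "S e" T] that by simp
    qed
    have "ip (surface e) (\<mu>b e) (\<lambda>x. \<Sum>T\<in>elements_at e. fst (\<zeta> T) e x)
        + vip (surface e) (\<mu>g e) (\<lambda>x. \<Sum>T\<in>elements_at e. snd (\<zeta> T) e x) = 0"
      if "e \<in> interior_faces \<Omega> Th F" for e
      using R that by (simp add: ip_def vip_def)
    then show "(\<Sum>T\<in>Th. b_form F T (v T) (\<zeta> T)) = 0"
      using sum_b_form[OF \<zeta> v \<mu>] by simp
  qed
next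
  assume L: ?L
  let ?I = "interior_faces \<Omega> Th F"
  define sb where "sb e = (\<lambda>x. \<Sum>T\<in>elements_at e. fst (\<zeta> T) e x)" for e
  define sg where "sg e = (\<lambda>x. \<Sum>T\<in>elements_at e. snd (\<zeta> T) e x)" for e
  have sb: "sb e \<in> Pf (k - 2) e" and sg: "sg e \<in> Pfv (k - 2) e" for e
    using \<zeta> unfolding sb_def sg_def face_space_def
    by (auto intro!: lincomb_closed_sum lincomb_closed_Pf lincomb_closed_Pfv simp: split_beta)
  \<comment> \<open>The triple is the same on every element, so its traces agree across interior
    faces, and it is set to zero on the remaining ones.\<close>
  define v :: "'n wg" where
    "v T = (\<lambda>_. 0, \<lambda>e. if e \<in> ?I then sb e else (\<lambda>_. 0), \<lambda>e. if e \<in> ?I then sg e else (\<lambda>_. 0))" for T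
  have "v \<in> Vh \<Omega> Th F k"
    using sb sg unfolding v_def Vh_def Wh_def W_local_def face_space_def
    by (auto intro: lincomb_closed_zero lincomb_closed_Pk lincomb_closed_Pf lincomb_closed_Pfv)
  then have v: "v \<in> Vh0 \<Omega> Th F k"
    unfolding Vh0_def by (auto simp: v_def interior_faces_def)
  have "(\<Sum>e\<in>?I. ip (surface e) (sb e) (sb e) + vip (surface e) (sg e) (sg e)) = 0"
    using L[rule_format, OF v] sum_b_form[OF \<zeta> v, of sb sg] unfolding sb_def sg_def by (simp add: v_def sb_def sg_def)
  moreover have "finite ?I" using finite_all_faces unfolding interior_faces_def by simp
  \<comment> \<open>A vanishing sum of nonnegative terms forces each face to contribute
    zero.\<close>
  ultimately have 0: "vip (surface e) (sb e) (sb e) + vip (surface e) (sg e) (sg e) = 0" if "e \<in> ?I" for e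
    using that unfolding ip_eq_vip by (subst (asm) sum_nonneg_eq_0_iff) (auto simp: vip_nonneg)
  have "sb e = (\<lambda>_. 0) \<and> sg e = (\<lambda>_. 0)" if "e \<in> ?I" for e
  proof -
    have face: "flat_face e" using flat_faces that unfolding interior_faces_def by blast
    have "vip (surface e) (sb e) (sb e) = 0" "vip (surface e) (sg e) (sg e) = 0"
      using 0[OF that] vip_nonneg[of "surface e" "sb e"] vip_nonneg[of "surface e" "sg e"] by linarith+
    then show ?thesis
      using l2_space.definite[OF l2_space_Pf[OF face] sb] l2_space.definite[OF l2_space_Pfv[OF face] sg] by blast
  qed
  then show ?R unfolding sb_def sg_def by blast
qed

text \<open>\<open>Sf\<close> is zero by definition off the interior faces, so equality of total
  functions reduces to those faces.\<close>

lemma Sf_eq_0_iff: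
  "Sf \<Omega> Th F k f w = (\<lambda>_ _. 0, \<lambda>_ _. 0) \<longleftrightarrow>
    (\<forall>e\<in>interior_faces \<Omega> Th F. (\<lambda>x. \<Sum>T\<in>elements_at e. fst (Lf F k f T w) e x) = (\<lambda>_. 0) \<and>
      (\<lambda>x. \<Sum>T\<in>elements_at e. snd (Lf F k f T w) e x) = (\<lambda>_. 0))"
  unfolding Sf_def by (auto simp: fun_eq_iff)

end

theorem theorem7p5:
  fixes \<Omega> :: "(real^'n) set" and Th :: "(real^'n) set set"
    and F :: "(real^'n) set \<Rightarrow> (real^'n) set set"
    and f \<xi> \<nu> :: "real^'n \<Rightarrow> real"
    and ub :: "'n face_fun" and ug :: "'n face_vfun"
    and u0 :: "(real^'n) set \<Rightarrow> real^'n \<Rightarrow> real"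
    and k N :: nat and \<rho>v \<rho>e \<kappa> \<sigma> \<gamma> \<theta>0 \<rho>s :: real
  assumes "CARD('n) = 2 \<or> CARD('n) = 3"
    and "lipschitz_domain \<Omega>"
    and "polytopal_mesh \<Omega> Th F"
    and "shape_regular \<rho>v \<rho>e \<kappa> \<sigma> \<gamma> \<theta>0 N \<rho>s Th F"
    and "k \<ge> 2"
    and "L2 (lebesgue_on \<Omega>) f"
    and "admissible_data \<Omega> Th F \<xi> \<nu>"
    and "(ub, ug) \<in> Bh Th F k"
    and "boundary_conditions \<Omega> Th F k \<xi> \<nu> (\<lambda>T. (u0 T, ub, ug))"
    and "\<And>T. T \<in> Th \<Longrightarrow> local_solution F k f T (u0 T, ub, ug)"
  shows "wg_solution \<Omega> Th F k f \<xi> \<nu> (\<lambda>T. (u0 T, ub, ug))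
    \<longleftrightarrow> Sf \<Omega> Th F k f (ub, ug) = (\<lambda>_ _. 0, \<lambda>_ _. 0)"
proof -
  interpret wg_mesh \<Omega> Th F k by unfold_locales (rule assms(3))
  let ?u = "\<lambda>T. (u0 T, ub, ug)" and ?\<zeta> = "\<lambda>T. Lf F k f T (ub, ug)"
  have \<Omega>: "open \<Omega>" "bounded \<Omega>" using assms(2) unfolding lipschitz_domain_def by auto
  have ubg: "(ub, ug) \<in> face_space k (F T)" if "T \<in> Th" for T
    using assms(8) that unfolding Bh_def all_faces_def face_space_def by auto
  have \<zeta>: "?\<zeta> T \<in> face_space k (F T)" if "T \<in> Th" for T
    by (rule wg_element.Lf_in[OF element ubg assms(10)]) (rule that)+
  \<comment> \<open>One family \<open>(ub, ug)\<close> serves all elements, so single-valuedness is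
    automatic. With the boundary conditions assumed, only the variational equation of the scheme is
    left.\<close>
  have "?u \<in> Vh \<Omega> Th F k"
    using ubg assms(10) unfolding Vh_def Wh_def W_local_def local_solution_def by auto
  then have "wg_solution \<Omega> Th F k f \<xi> \<nu> ?u \<longleftrightarrow>
      (\<forall>v\<in>Vh0 \<Omega> Th F k. (\<Sum>T\<in>Th. as_form F k T (?u T) (v T)) = load \<Omega> Th f v)"
    unfolding wg_solution_def using assms(9) by blast
  also have "\<dots> \<longleftrightarrow> (\<forall>v\<in>Vh0 \<Omega> Th F k. (\<Sum>T\<in>Th. b_form F T (v T) (?\<zeta> T)) = 0)"
  proof (rule ball_cong[OF refl])
    fix v assume "v \<in> Vh0 \<Omega> Th F k"
    then have v: "v T \<in> W_local F k T" if "T \<in> Th" for T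
      using that by (rule Vh0_in_W_local)
    then have "real_polynomial_function (fst (v T))" if "T \<in> Th" for T
      using that real_polynomial_function_Pk unfolding W_local_def by fastforce
    then have "load \<Omega> Th f v = (\<Sum>T\<in>Th. ip (lebesgue_on T) f (fst (v T)))"
      by (rule load_eq_sum[OF \<Omega> assms(6)])
    \<comment> \<open>The interior parts add up to exactly the load, so the two sides of the scheme
      differ by the interface terms.\<close>
    moreover have "(\<Sum>T\<in>Th. as_form F k T (?u T) (v T))
        = (\<Sum>T\<in>Th. ip (lebesgue_on T) f (fst (v T)) + b_form F T (v T) (?\<zeta> T))"
      using wg_element.as_form_local_solution_split[OF element ubg assms(10) v]
      by (intro sum.cong) auto
    ultimately show "(\<Sum>T\<in>Th. as_form F k T (?u T) (v T)) = load \<Omega> Th f v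
        \<longleftrightarrow> (\<Sum>T\<in>Th. b_form F T (v T) (?\<zeta> T)) = 0"
      by (simp add: sum.distrib)
  qed
  also have "\<dots> \<longleftrightarrow> Sf \<Omega> Th F k f (ub, ug) = (\<lambda>_ _. 0, \<lambda>_ _. 0)"
    using sum_b_form_eq_0_iff[of ?\<zeta>, OF \<zeta>] unfolding Sf_eq_0_iff .
  finally show ?thesis .
qed

end
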